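(* Let $(X,[\cdot,\cdot],\|\cdot\|)$ be a real Banach–Lie algebra with $\|[g,g']\|\le\|g\|\,\|g'\|$ for all $g,g'\in X$. Let $$\Gamma:=\Big\{(a,b)\in X\times X:\ \|a\|<2\pi,\ \ \|b\|<\int_{\|a\|}^{2\pi}\frac{du}{G(u)}\Big\},\qquad G(u)=2+\frac u2\Big(1-\cot\frac u2\Big)\ (u\in(-2\pi,2\pi)).$$ Then for every $(a,b)\in\Gamma$ the homogeneous CBHD series $\sum_{n=0}^\infty\big(\sum_{i+j=n}Z_{i,j}(a,b)\big)$ converges in $X$. The same holds for every $(a,b)$ with $\|b\|<2\pi$ and $\|a\|<\int_{\|b\|}^{2\pi}\frac{du}{G(u)}$.
   Context: Let $\mathscr T_{\mathbb R}(x,y)$ be the unital associative algebra of real polynomials in two non-commuting indeterminates $x,y$. For $i,j\in\mathbb N$ with $i+j\ge1$, $$Z_{i,j}(x,y):=\sum_{n=1}^{i+j}\frac{(-1)^{n+1}}{n}\sum_{\substack{(i_1,j_1),\dots,(i_n,j_n)\ne(0,0)\\ i_1+\dots+i_n=i,\ j_1+\dots+j_n=j}}\frac{x^{i_1}y^{j_1}\cdots x^{i_n}y^{j_n}}{i_1!j_1!\cdots i_n!j_n!},$$ and $Z_{0,0}:=0$. Each $Z_{i,j}$ belongs to the Lie subalgebra $\mathcal L(x,y)$ of $\mathscr T_{\mathbb R}(x,y)$ (with commutator bracket) generated by $x,y$. For $a,b\in X$, $u_{a,b}:\mathcal L(x,y)\to X$ is the unique Lie algebra morphism with $u_{a,b}(x)=a$,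 $u_{a,b}(y)=b$, and $Z_{i,j}(a,b):=u_{a,b}(Z_{i,j}(x,y))$. Also $\sum_{n\ge0}|K_n|u^n=G(u)$ where $\sum_nK_nz^n=\frac z{e^z-1}$. *)

theory Defs
  imports "HOL-Analysis.Analysis"
begin

definition banach_lie :: "('a::banach \<Rightarrow> 'a \<Rightarrow> 'a) \<Rightarrow> bool" where
  "banach_lie br \<longleftrightarrow>
     (\<forall>x y z. br (x + y) z = br x z + br y z) \<and>
     (\<forall>x y z. br x (y + z) = br x y + br x z) \<and>
     (\<forall>c x y. br (c *\<^sub>R x) y = c *\<^sub>R br x y) \<and>
     (\<forall>c x y. br x (c *\<^sub>R y) = c *\<^sub>R br x y) \<and>
     (\<forall>x. br x x = 0) \<and>
     (\<forall>x y z. br x (br y z) + br y (br z x) + br z (br x y) = 0) \<and>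
     (\<forall>x y. norm (br x y) \<le> norm x * norm y)"

text \<open>Non-commuting indeterminates x (GX) and y (GY); elements of the free associative
  algebra T(x,y) are represented by their coefficient functions on words.\<close>
datatype gen = GX | GY

type_synonym ncpoly = "gen list \<Rightarrow> real"

definition PX :: ncpoly where "PX = (\<lambda>w. if w = [GX] then 1 else 0)"
definition PY :: ncpoly where "PY = (\<lambda>w. if w = [GY] then 1 else 0)"

definition padd :: "ncpoly \<Rightarrow> ncpoly \<Rightarrow> ncpoly" where
  "padd p q = (\<lambda>w. p w + q w)"

definition psmult :: "real \<Rightarrow> ncpoly \<Rightarrow> ncpoly" where
  "psmult c p = (\<lambda>w. c * p w)"

definition pmult :: "ncpoly \<Rightarrow> ncpoly \<Rightarrow> ncpoly" where
  "pmult p q = (\<lambda>w. \<Sum>k\<le>length w. p (take k w) * q (drop k w))"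

definition pbr :: "ncpoly \<Rightarrow> ncpoly \<Rightarrow> ncpoly" where
  "pbr p q = (\<lambda>w. pmult p q w - pmult q p w)"

inductive_set Lie_xy :: "ncpoly set" where
  gen_x: "PX \<in> Lie_xy"
| gen_y: "PY \<in> Lie_xy"
| add: "p \<in> Lie_xy \<Longrightarrow> q \<in> Lie_xy \<Longrightarrow> padd p q \<in> Lie_xy"
| smult: "p \<in> Lie_xy \<Longrightarrow> psmult c p \<in> Lie_xy"
| br: "p \<in> Lie_xy \<Longrightarrow> q \<in> Lie_xy \<Longrightarrow> pbr p q \<in> Lie_xy"

text \<open>u_{a,b}: the unique Lie algebra morphism L(x,y) \<rightarrow> X with x \<mapsto> a, y \<mapsto> b
  (normalized to 0 outside L(x,y) so that it is unique as a HOL function).\<close>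
definition lie_eval :: "('a::banach \<Rightarrow> 'a \<Rightarrow> 'a) \<Rightarrow> 'a \<Rightarrow> 'a \<Rightarrow> ncpoly \<Rightarrow> 'a" where
  "lie_eval br a b = (THE u.
      (\<forall>p\<in>Lie_xy. \<forall>q\<in>Lie_xy. u (padd p q) = u p + u q \<and> u (pbr p q) = br (u p) (u q)) \<and>
      (\<forall>c. \<forall>p\<in>Lie_xy. u (psmult c p) = c *\<^sub>R u p) \<and>
      u PX = a \<and> u PY = b \<and>
      (\<forall>p. p \<notin> Lie_xy \<longrightarrow> u p = 0))"

definition word_of :: "(nat \<times> nat) list \<Rightarrow> gen list" where
  "word_of s = concat (map (\<lambda>(i, j). replicate i GX @ replicate j GY) s)"

definition seqs :: "nat \<Rightarrow> nat \<Rightarrow> nat \<Rightarrow> (nat \<times> nat) list set" where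
  "seqs n i j = {s. length s = n \<and> (\<forall>p\<in>set s. p \<noteq> (0, 0)) \<and>
                   sum_list (map fst s) = i \<and> sum_list (map snd s) = j}"

definition Zpoly :: "nat \<Rightarrow> nat \<Rightarrow> ncpoly" where
  "Zpoly i j = (if i + j = 0 then (\<lambda>w. 0) else
     (\<lambda>w. \<Sum>n=1..i+j. ((-1) ^ (n + 1) / real n) *
        (\<Sum>s\<in>seqs n i j. if word_of s = w
            then 1 / (\<Prod>p\<leftarrow>s. fact (fst p) * fact (snd p)) else 0)))"

definition Zeval :: "('a::banach \<Rightarrow> 'a \<Rightarrow> 'a) \<Rightarrow> nat \<Rightarrow> nat \<Rightarrow> 'a \<Rightarrow> 'a \<Rightarrow> 'a" where
  "Zeval br i j a b = lie_eval br a b (Zpoly i j)"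

text \<open>G(u) = 2 + u/2 (1 - cot(u/2)), with its continuous value G(0) = 1.\<close>
definition Gfun :: "real \<Rightarrow> real" where
  "Gfun u = (if u = 0 then 1 else 2 + u / 2 * (1 - cot (u / 2)))"

end

theory Submission
  imports Defs "HOL-Computational_Algebra.Formal_Power_Series"
begin

text \<open>
  In the algebra of formal word series, \<open>Z = log (exp x * exp y)\<close> satisfies
  \<open>E Z = \<kappa> (ad Z) y\<close>, where \<open>E\<close> multiplies each word by its number of letters \<open>y\<close> and
  \<open>\<kappa> z = z / (1 - exp (- z))\<close>. Together with \<open>Z = x\<close> in degree 0 in \<open>y\<close>, this recursion
  in the number of letters \<open>y\<close> expresses every bihomogeneous component of \<open>Z\<close> by brackets of lower
  ones; so the components are Lie elements, and their values in \<open>X\<close> satisfy the same recursion.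

  Hence the polynomials \<open>S t = (\<Sum>i, j \<le> N. norm (Z i j (a, b)) * t ^ j)\<close> satisfy
  \<open>S 0 = norm a\<close> and \<open>S' \<le> norm b * G (S)\<close>, because \<open>G\<close> bounds the partial sums of
  \<open>\<Sum>n. abs (\<kappa> $ n) * u ^ n\<close>. Separation of variables bounds \<open>S 1\<close> by \<open>2 * pi\<close> for all \<open>N\<close>.
  The second region is obtained from \<open>log (exp x * exp y) = - log (exp (- y) * exp (- x))\<close>.

  The evaluation morphism exists by the Dynkin--Specht--Wever formula: on Lie elements of degree
  \<open>n\<close> it is \<open>1 / n\<close> times the map sending a word to its right-nested bracket.
\<close>

unbundle no vec_syntax
unbundle fps_syntax

section \<open>Evaluation of Lie elements\<close>

definition words :: "nat \<Rightarrow> gen list set" where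
  "words n = {w. length w = n}"

lemma finite_words [simp, intro]: "finite (words n)"
proof -
  have "(UNIV :: gen set) = {GX, GY}"
    using gen.exhaust by blast
  then have "finite (UNIV :: gen set)"
    by (metis finite.emptyI finite_insert)
  from finite_lists_length_eq[OF this, of n] show ?thesis
    by (simp add: words_def)
qed

text \<open>Cutting after \<open>k\<close> letters is a bijection onto pairs of words of lengths
  \<open>k\<close> and \<open>n - k\<close>. The weight \<open>F\<close> is arbitrary because both
  \<open>word_act\<close> and \<open>word_br\<close> are later summed over words.\<close>

lemma sum_words_pmult:
  fixes F :: "gen list \<Rightarrow> 'a::real_vector"
  shows "(\<Sum>w\<in>words n. pmult p q w *\<^sub>R F w) =
    (\<Sum>k\<le>n. \<Sum>v\<in>words k. \<Sum>w\<in>words (n - k). (p v * q w) *\<^sub>R F (v @ w))"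
proof -
  have "(\<Sum>w\<in>words n. pmult p q w *\<^sub>R F w) =
      (\<Sum>w\<in>words n. \<Sum>k\<le>n. (p (take k w) * q (drop k w)) *\<^sub>R F w)"
    by (intro sum.cong refl) (simp add: pmult_def words_def scaleR_left.sum)
  also have "\<dots> = (\<Sum>k\<le>n. \<Sum>w\<in>words n. (p (take k w) * q (drop k w)) *\<^sub>R F w)"
    by (rule sum.swap)
  also have "\<dots> = (\<Sum>k\<le>n. \<Sum>(v, w)\<in>words k \<times> words (n - k). (p v * q w) *\<^sub>R F (v @ w))"
  proof (intro sum.cong refl)
    fix k assume "k \<in> {..n}"
    then show "(\<Sum>w\<in>words n. (p (take k w) * q (drop k w)) *\<^sub>R F w) =
        (\<Sum>(v, w)\<in>words k \<times> words (n - k). (p v * q w) *\<^sub>R F (v @ w))"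
      by (intro sum.reindex_bij_witness[of _ "\<lambda>(v, w). v @ w" "\<lambda>w. (take k w, drop k w)"])
        (auto simp: words_def)
  qed
  finally show ?thesis
    by (simp add: sum.cartesian_product)
qed

locale lie_pair =
  fixes br :: "'a::banach \<Rightarrow> 'a \<Rightarrow> 'a" and a b :: 'a
  assumes lie: "banach_lie br"
begin

sublocale br: bounded_bilinear br
  using lie unfolding banach_lie_def
  by unfold_locales (auto intro!: exI[of _ 1])

lemma br_norm: "norm (br x y) \<le> norm x * norm y"
  using lie unfolding banach_lie_def by blast

lemma br_skew: "br y x = - br x y"
proof -
  have "br (x + y) (x + y) = 0" "br x x = 0" "br y y = 0"
    using lie unfolding banach_lie_def by blast+
  then show ?thesis
    by (simp add: br.add_left br.add_right eq_neg_iff_add_eq_0)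
qed

lemma br_br: "br (br x y) z = br x (br y z) - br y (br x z)"
proof -
  have "br x (br y z) + br y (br z x) + br z (br x y) = 0"
    using lie unfolding banach_lie_def by blast
  then show ?thesis
    using br_skew[of z x] br_skew[of z "br x y"]
    by (simp add: br.minus_right algebra_simps)
qed

section \<open>The adjoint action of words and the Dynkin map\<close>

definition gen_val :: "gen \<Rightarrow> 'a" where
  "gen_val g = (case g of GX \<Rightarrow> a | GY \<Rightarrow> b)"

primrec word_act :: "gen list \<Rightarrow> 'a \<Rightarrow> 'a" where
  "word_act [] z = z"
| "word_act (g # w) z = br (gen_val g) (word_act w z)"

text \<open>The value at the empty word is a placeholder; the product rules below therefore ask for
  vanishing constant terms.\<close>

primrec word_br :: "gen list \<Rightarrow> 'a" where
  "word_br [] = 0"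
| "word_br (g # w) = (if w = [] then gen_val g else br (gen_val g) (word_br w))"

lemma word_act_append: "word_act (v @ w) z = word_act v (word_act w z)"
  by (induction v) auto

lemma word_br_append: "w \<noteq> [] \<Longrightarrow> word_br (v @ w) = word_act v (word_br w)"
  by (induction v) auto

lemma linear_word_act: "linear (word_act w)"
proof (induction w)
  case Nil
  then show ?case by (simp add: linear_iff)
next
  case (Cons g w)
  then show ?case by (simp add: linear_iff br.add_right br.scaleR_right)
qed

lemmas word_act_sum = linear_sum[OF linear_word_act]
  and word_act_scaleR = linear_cmul[OF linear_word_act]

definition ad_part :: "nat \<Rightarrow> ncpoly \<Rightarrow> 'a \<Rightarrow> 'a" where
  "ad_part n p z = (\<Sum>w\<in>words n. p w *\<^sub>R word_act w z)"

definition br_part :: "nat \<Rightarrow> ncpoly \<Rightarrow> 'a" where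
  "br_part n p = (\<Sum>w\<in>words n. p w *\<^sub>R word_br w)"

definition ev_part :: "nat \<Rightarrow> ncpoly \<Rightarrow> 'a" where
  "ev_part n p = (1 / real n) *\<^sub>R br_part n p"

lemma br_part_0 [simp]: "br_part 0 p = 0"
  by (simp add: br_part_def words_def)

lemma ev_part_0 [simp]: "ev_part 0 p = 0"
  by (simp add: ev_part_def)

lemma br_part_eq: "br_part n p = real n *\<^sub>R ev_part n p"
  by (cases "n = 0") (simp_all add: ev_part_def)

lemma ad_part_pmult: "ad_part n (pmult p q) z = (\<Sum>k\<le>n. ad_part k p (ad_part (n - k) q z))"
  unfolding ad_part_def sum_words_pmult
  by (simp add: word_act_append word_act_sum word_act_scaleR scaleR_sum_right)

text \<open>For nonempty \<open>w\<close>, the right-nested bracket of \<open>v @ w\<close> is the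
  action of \<open>v\<close> on the bracket of \<open>w\<close>; the assumption on \<open>q\<close>
  removes the empty suffix.\<close>

lemma br_part_pmult:
  assumes "q [] = 0"
  shows "br_part n (pmult p q) = (\<Sum>k\<le>n. ad_part k p (br_part (n - k) q))"
proof -
  have "(p v * q w) *\<^sub>R word_br (v @ w) = p v *\<^sub>R word_act v (q w *\<^sub>R word_br w)" for v w
    using assms by (cases "w = []") (simp_all add: word_br_append word_act_scaleR linear_0[OF linear_word_act])
  then show ?thesis
    unfolding br_part_def ad_part_def sum_words_pmult
    by (simp add: word_act_sum scaleR_sum_right)
qed

lemma ad_part_diff: "ad_part n (\<lambda>w. p w - q w) z = ad_part n p z - ad_part n q z"
  by (simp add: ad_part_def scaleR_left_diff_distrib sum_subtractf)

lemma br_part_diff: "br_part n (\<lambda>w. p w - q w) = br_part n p - br_part n q"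
  by (simp add: br_part_def scaleR_left_diff_distrib sum_subtractf)

lemma ad_part_padd: "ad_part n (padd p q) z = ad_part n p z + ad_part n q z"
  by (simp add: ad_part_def padd_def scaleR_left_distrib sum.distrib)

lemma ad_part_psmult: "ad_part n (psmult c p) z = c *\<^sub>R ad_part n p z"
  by (simp add: ad_part_def psmult_def scaleR_sum_right)

lemma ev_part_padd: "ev_part n (padd p q) = ev_part n p + ev_part n q"
  by (simp add: ev_part_def br_part_def padd_def scaleR_left_distrib scaleR_right_distrib sum.distrib)

lemma ev_part_psmult: "ev_part n (psmult c p) = c *\<^sub>R ev_part n p"
  by (simp add: ev_part_def br_part_def psmult_def scaleR_sum_right mult_ac)

text \<open>The identity \<open>ad_part n p = br (ev_part n p)\<close> makes
  \<open>br_part\<close> act as a derivation, so \<open>br_part n\<close> is \<open>n\<close> times a bracket morphism.\<close>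

lemma ev_part_pbr:
  assumes "p [] = 0" "q [] = 0"
    and p: "\<And>n z. ad_part n p z = br (ev_part n p) z"
    and q: "\<And>n z. ad_part n q z = br (ev_part n q) z"
  shows "ev_part n (pbr p q) = (\<Sum>k\<le>n. br (ev_part k p) (ev_part (n - k) q))"
proof (cases "n = 0")
  case False
  have "br_part n (pmult p q) = (\<Sum>k\<le>n. real (n - k) *\<^sub>R br (ev_part k p) (ev_part (n - k) q))"
    unfolding br_part_pmult[of q, OF assms(2)] p by (simp add: br_part_eq br.scaleR_right)
  moreover have "br_part n (pmult q p) = (\<Sum>k\<le>n. real (n - k) *\<^sub>R br (ev_part k q) (ev_part (n - k) p))"
    unfolding br_part_pmult[of p, OF assms(1)] q by (simp add: br_part_eq br.scaleR_right)
  moreover have "\<dots> = (\<Sum>k\<le>n. real k *\<^sub>R br (ev_part (n - k) q) (ev_part k p))"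
    by (rule sum.reindex_bij_witness[of _ "\<lambda>k. n - k" "\<lambda>k. n - k"]) auto
  moreover have "\<dots> = - (\<Sum>k\<le>n. real k *\<^sub>R br (ev_part k p) (ev_part (n - k) q))"
    unfolding sum_negf[symmetric]
    by (intro sum.cong refl) (metis br_skew scaleR_minus_right)
  \<comment> \<open>By skew symmetry the second product carries the weight \<open>k\<close> where
    the first carries \<open>n - k\<close>; together they give the factor \<open>n\<close> that
    \<open>ev_part\<close> divides out.\<close>
  ultimately have "br_part n (pbr p q) = (\<Sum>k\<le>n. real n *\<^sub>R br (ev_part k p) (ev_part (n - k) q))"
    unfolding pbr_def br_part_diff
    by (simp add: sum.distrib[symmetric] scaleR_left_distrib[symmetric] of_nat_diff cong: sum.cong_simp)
  then show ?thesis
    using False by (simp add: ev_part_def[of n] scaleR_sum_right[symmetric])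
qed (simp add: br.zero_left)

text \<open>The two products act by composed brackets. Reflecting \<open>k\<close> to
  \<open>n - k\<close> in one of them aligns the terms, and the Jacobi identity \<open>br_br\<close>
  turns their difference into a single bracket.\<close>

lemma ad_part_pbr:
  assumes "p [] = 0" "q [] = 0"
    and p: "\<And>n z. ad_part n p z = br (ev_part n p) z"
    and q: "\<And>n z. ad_part n q z = br (ev_part n q) z"
  shows "ad_part n (pbr p q) z = br (ev_part n (pbr p q)) z"
proof -
  have "ad_part n (pmult q p) z = (\<Sum>k\<le>n. br (ev_part k q) (br (ev_part (n - k) p) z))"
    by (simp add: ad_part_pmult p q)
  also have "\<dots> = (\<Sum>k\<le>n. br (ev_part (n - k) q) (br (ev_part k p) z))"
    by (rule sum.reindex_bij_witness[of _ "\<lambda>k. n - k" "\<lambda>k. n - k"]) auto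
  finally show ?thesis
    unfolding ev_part_pbr[OF assms] unfolding pbr_def ad_part_diff
    by (simp add: ad_part_pmult p q br.sum_left br_br sum_subtractf)
qed

lemma ad_part_letter:
  fixes g :: gen
  defines "p \<equiv> \<lambda>w. if w = [g] then 1 else 0"
  shows "ev_part n p = (if n = 1 then gen_val g else 0)"
    and "ad_part n p z = br (ev_part n p) z"
proof -
  have sum: "(\<Sum>w\<in>words n. p w *\<^sub>R F w) = (if n = 1 then F [g] else 0)" for F :: "gen list \<Rightarrow> 'a"
  proof -
    have "(\<Sum>w\<in>words n. p w *\<^sub>R F w) = (\<Sum>w\<in>words n. if w = [g] then F w else 0)"
      by (intro sum.cong refl) (simp add: p_def)
    also have "\<dots> = (if [g] \<in> words n then F [g] else 0)"
      by (simp add: sum.delta)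
    finally show ?thesis by (auto simp: words_def)
  qed
  show "ev_part n p = (if n = 1 then gen_val g else 0)"
    by (simp add: ev_part_def br_part_def sum)
  then show "ad_part n p z = br (ev_part n p) z"
    by (simp add: ad_part_def sum br.zero_left)
qed

lemma Lie_xy_ad_part:
  assumes "p \<in> Lie_xy"
  shows "p [] = 0 \<and> (\<forall>n z. ad_part n p z = br (ev_part n p) z)"
  using assms
proof (induction rule: Lie_xy.induct)
  case gen_x
  show ?case using ad_part_letter(2)[of _ GX] by (simp add: PX_def)
next
  case gen_y
  show ?case using ad_part_letter(2)[of _ GY] by (simp add: PY_def)
next
  case (add p q)
  then show ?case
    by (simp add: ad_part_padd ev_part_padd br.add_left) (simp add: padd_def)
next
  case (smult p c)
  then show ?case
    by (simp add: ad_part_psmult ev_part_psmult br.scaleR_left) (simp add: psmult_def)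
next
  case (br p q)
  then show ?case
    by (simp add: ad_part_pbr) (simp add: pbr_def pmult_def)
qed

text \<open>Lie elements are polynomials, which makes the sum over degrees in
  \<open>lie_morph\<close> finite. For a bracket, a degree above \<open>M + N\<close> forces one
  factor above its own bound.\<close>

lemma Lie_xy_ev_part_eventually_0:
  assumes "p \<in> Lie_xy"
  shows "\<exists>N. \<forall>n>N. ev_part n p = 0"
  using assms
proof (induction rule: Lie_xy.induct)
  case gen_x
  show ?case using ad_part_letter(1)[of _ GX] by (auto simp: PX_def intro!: exI[of _ 1])
next
  case gen_y
  show ?case using ad_part_letter(1)[of _ GY] by (auto simp: PY_def intro!: exI[of _ 1])
next
  case (add p q)
  then obtain M N where "\<forall>n>M. ev_part n p = 0" "\<forall>n>N. ev_part n q = 0" by blast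
  then show ?case by (auto simp: ev_part_padd intro!: exI[of _ "max M N"])
next
  case (smult p c)
  then show ?case by (auto simp: ev_part_psmult)
next
  case (br p q)
  then obtain M N where MN: "\<forall>n>M. ev_part n p = 0" "\<forall>n>N. ev_part n q = 0" by blast
  have "ev_part n (pbr p q) = 0" if "n > M + N" for n
  proof -
    have "br (ev_part k p) (ev_part (n - k) q) = 0" for k
      using MN that by (cases "k > M") (auto simp: br.zero_left br.zero_right)
    then show ?thesis
      using br.hyps Lie_xy_ad_part by (simp add: ev_part_pbr)
  qed
  then show ?case by blast
qed

section \<open>Existence and uniqueness of the evaluation morphism\<close>

definition lie_morph :: "ncpoly \<Rightarrow> 'a" where
  "lie_morph p = (if p \<in> Lie_xy then \<Sum>n. ev_part n p else 0)"

lemma lie_morph_sums: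
  assumes "p \<in> Lie_xy"
  shows "(\<lambda>n. ev_part n p) sums lie_morph p"
proof -
  obtain N where "\<forall>n>N. ev_part n p = 0"
    using Lie_xy_ev_part_eventually_0[OF assms] by blast
  then have "summable (\<lambda>n. ev_part n p)"
    by (intro summable_finite[of "{..N}"]) (auto simp: not_le)
  then show ?thesis
    using assms by (simp add: lie_morph_def summable_sums)
qed

text \<open>Degreewise the bracket is a Cauchy product, so summing over all degrees gives the
  bracket of two finite sums.\<close>

lemma lie_morph_pbr:
  assumes "p \<in> Lie_xy" "q \<in> Lie_xy"
  shows "lie_morph (pbr p q) = br (lie_morph p) (lie_morph q)"
proof -
  obtain M N where MN: "\<forall>n>M. ev_part n p = 0" "\<forall>n>N. ev_part n q = 0"
    using assms Lie_xy_ev_part_eventually_0 by metis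
  let ?f = "\<lambda>k l. br (ev_part k p) (ev_part l q)"
  have zero: "?f k l = 0" if "k > M \<or> l > N" for k l
    using MN that by (auto simp: br.zero_left br.zero_right)
  have ev: "ev_part n (pbr p q) = (\<Sum>k\<le>n. ?f k (n - k))" for n
    using assms Lie_xy_ad_part by (simp add: ev_part_pbr)
  have "(\<lambda>n. ev_part n (pbr p q)) sums (\<Sum>n\<le>M + N. ev_part n (pbr p q))"
  proof (rule sums_finite)
    fix n assume "n \<notin> {..M + N}"
    then have "k > M \<or> n - k > N" for k by auto
    then show "ev_part n (pbr p q) = 0"
      unfolding ev by (intro sum.neutral ballI zero)
  qed simp
  moreover have "lie_morph p = (\<Sum>k\<le>M. ev_part k p)" "lie_morph q = (\<Sum>l\<le>N. ev_part l q)"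
    using MN by (auto intro!: sums_unique2[OF lie_morph_sums] sums_finite assms) (meson not_le_imp_less)+
  moreover have "(\<Sum>n\<le>M + N. ev_part n (pbr p q)) = (\<Sum>k\<le>M. \<Sum>l\<le>N. ?f k l)"
  proof -
    have "(\<Sum>n\<le>M + N. ev_part n (pbr p q)) = (\<Sum>(n, k)\<in>(SIGMA n:{..M + N}. {..n}). ?f k (n - k))"
      unfolding ev by (simp add: sum.Sigma)
    also have "\<dots> = (\<Sum>(k, l)\<in>{(k, l). k + l \<le> M + N}. ?f k l)"
      by (rule sum.reindex_bij_witness[of _ "\<lambda>(k, l). (k + l, k)" "\<lambda>(n, k). (k, n - k)"]) auto
    also have "\<dots> = (\<Sum>(k, l)\<in>{..M} \<times> {..N}. ?f k l)"
    proof (rule sum.mono_neutral_right)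
      show "finite {(k, l). k + l \<le> M + N}"
        by (rule finite_subset[of _ "{..M + N} \<times> {..M + N}"]) auto
    qed (auto, (meson zero not_le)+)
    finally show ?thesis by (simp add: sum.cartesian_product)
  qed
  ultimately show ?thesis
    using sums_unique2[OF lie_morph_sums[OF Lie_xy.br[OF assms]]]
    by (simp only: br.sum_left br.sum_right) (rule sum.swap)
qed

lemma lie_morph_letters: "lie_morph PX = a" "lie_morph PY = b"
proof -
  have "(\<lambda>n. if n = 1 then gen_val g else 0) sums gen_val g" for g
    using sums_single[of 1 "\<lambda>_. gen_val g"] by simp
  then have "(\<lambda>n. ev_part n PX) sums gen_val GX" "(\<lambda>n. ev_part n PY) sums gen_val GY"
    unfolding PX_def PY_def ad_part_letter(1) by blast+
  then show "lie_morph PX = a" "lie_morph PY = b"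
    using sums_unique2[OF lie_morph_sums[OF Lie_xy.gen_x]] sums_unique2[OF lie_morph_sums[OF Lie_xy.gen_y]]
    by (auto simp: gen_val_def)
qed

text \<open>The normalisation outside \<open>Lie_xy\<close> is left out, so that composed maps can
  be compared on \<open>Lie_xy\<close> alone.\<close>

definition is_lie_morph :: "(ncpoly \<Rightarrow> 'a) \<Rightarrow> bool" where
  "is_lie_morph u \<longleftrightarrow>
     (\<forall>p\<in>Lie_xy. \<forall>q\<in>Lie_xy. u (padd p q) = u p + u q \<and> u (pbr p q) = br (u p) (u q)) \<and>
     (\<forall>c. \<forall>p\<in>Lie_xy. u (psmult c p) = c *\<^sub>R u p) \<and> u PX = a \<and> u PY = b"

lemma is_lie_morph_lie_morph: "is_lie_morph lie_morph"
proof -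
  have "lie_morph (padd p q) = lie_morph p + lie_morph q" if "p \<in> Lie_xy" "q \<in> Lie_xy" for p q
    using sums_unique2[OF lie_morph_sums[OF Lie_xy.add[OF that]]] sums_add[OF that[THEN lie_morph_sums]]
    by (simp add: ev_part_padd)
  moreover have "lie_morph (psmult c p) = c *\<^sub>R lie_morph p" if "p \<in> Lie_xy" for c p
    using sums_unique2[OF lie_morph_sums[OF Lie_xy.smult[OF that]]] sums_scaleR_right[OF that[THEN lie_morph_sums]]
    by (simp add: ev_part_psmult)
  ultimately show ?thesis
    unfolding is_lie_morph_def by (simp add: lie_morph_pbr lie_morph_letters)
qed

lemma is_lie_morph_unique:
  assumes "is_lie_morph u" "is_lie_morph v" "p \<in> Lie_xy"
  shows "u p = v p"
  using assms(3) by (induction rule: Lie_xy.induct) (use assms(1,2) in \<open>auto simp: is_lie_morph_def\<close>)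

lemma lie_eval_eq_lie_morph: "lie_eval br a b = lie_morph"
proof -
  have "lie_eval br a b = (THE u. is_lie_morph u \<and> (\<forall>p. p \<notin> Lie_xy \<longrightarrow> u p = 0))"
    unfolding lie_eval_def is_lie_morph_def by (simp add: conj_assoc)
  also have "\<dots> = lie_morph"
  proof (rule the_equality)
    show "is_lie_morph lie_morph \<and> (\<forall>p. p \<notin> Lie_xy \<longrightarrow> lie_morph p = 0)"
      using is_lie_morph_lie_morph by (simp add: lie_morph_def)
    show "u = lie_morph" if "is_lie_morph u \<and> (\<forall>p. p \<notin> Lie_xy \<longrightarrow> u p = 0)" for u
    proof
      fix p show "u p = lie_morph p"
        using that is_lie_morph_unique[OF _ is_lie_morph_lie_morph]
        by (cases "p \<in> Lie_xy") (auto simp: lie_morph_def)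
    qed
  qed
  finally show ?thesis .
qed

lemma is_lie_morph_lie_eval: "is_lie_morph (lie_eval br a b)"
  by (simp add: lie_eval_eq_lie_morph is_lie_morph_lie_morph)

end

section \<open>The coefficients of z / (1 - exp (- z))\<close>

text \<open>This is \<open>(exp z - 1) / z\<close>.\<close>

definition fps_expm1_quot :: "real fps" where
  "fps_expm1_quot = Abs_fps (\<lambda>n. 1 / fact (Suc n))"

text \<open>This is \<open>z / (1 - exp (- z))\<close>, so \<open>kappa $ n\<close> is \<open>(- 1) ^ n\<close> times the number \<open>K_n\<close>
  of the paper.\<close>

definition kappa :: "real fps" where
  "kappa = inverse fps_expm1_quot * fps_exp 1"

lemma fps_X_mult_expm1_quot: "fps_X * fps_expm1_quot = fps_exp 1 - 1"
  by (rule fps_ext) (auto simp: fps_expm1_quot_def fps_X_mult_nth fact_num_eq_if[symmetric] gr0_conv_Suc)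

lemma inverse_expm1_quot: "inverse fps_expm1_quot * fps_expm1_quot = 1"
  by (rule inverse_mult_eq_1) (simp add: fps_expm1_quot_def)

lemma kappa_mult_expm1: "kappa * (fps_exp 1 - 1) = fps_X * fps_exp 1"
proof -
  have "kappa * (fps_exp 1 - 1) = (inverse fps_expm1_quot * fps_expm1_quot) * (fps_X * fps_exp 1)"
    by (simp only: kappa_def fps_X_mult_expm1_quot[symmetric] mult_ac)
  then show ?thesis by (simp add: inverse_expm1_quot)
qed

text \<open>This is \<open>z/2 * coth (z/2)\<close>.\<close>

definition kappa_even :: "real fps" where
  "kappa_even = kappa - fps_const (1/2) * fps_X"

text \<open>Here \<open>e\<close>, \<open>X\<close>, \<open>h\<close> stand for
  \<open>exp z\<close>, \<open>z\<close>, \<open>1/2\<close>. The first claim passes from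
  \<open>kappa\<close> to \<open>kappa_even\<close>; in the second \<open>k\<close> is
  \<open>kappa_even\<close> and \<open>d\<close> its derivative. In an abstract ring both are
  polynomial identities.\<close>

lemma riccati_aux:
  fixes h e X k d :: "'a::comm_ring_1"
  assumes h: "h * 2 = 1"
  shows "k * (e - 1) = X * e \<Longrightarrow> (k - h * X) * (e - 1) = h * X * (e + 1)"
    and "k * (e - 1) = h * X * (e + 1) \<Longrightarrow> d * (e - 1) = h * (e + 1) + h * X * e - k * e \<Longrightarrow>
      X * d * (e - 1)\<^sup>2 = (k - k\<^sup>2 + h * h * X\<^sup>2) * (e - 1)\<^sup>2"
proof -
  assume k: "k * (e - 1) = X * e"
  have "(k - h * X) * (e - 1) = (h * 2) * (X * e) - h * X * (e - 1)"
    unfolding h left_diff_distrib k by simp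
  then show "(k - h * X) * (e - 1) = h * X * (e + 1)"
    by (simp add: algebra_simps)
next
  assume k: "k * (e - 1) = h * X * (e + 1)" and d: "d * (e - 1) = h * (e + 1) + h * X * e - k * e"
  have "X * d * (e - 1)\<^sup>2 = X * (e - 1) * (d * (e - 1))"
    by (simp add: power2_eq_square mult_ac)
  also have "\<dots> = X * (e - 1) * (h * (e + 1) + h * X * e) - X * e * (k * (e - 1))"
    unfolding d by (simp add: algebra_simps)
  also have "\<dots> = h * X * (e + 1) * (e - 1) - (h * 2) * (X * X * e)"
    unfolding k by (simp add: algebra_simps)
  \<comment> \<open>The additional factor \<open>h * 2 = 1\<close> allows the use of
    \<open>4 * e = (e + 1)^2 - (e - 1)^2\<close>.\<close>
  also have "\<dots> = h * X * (e + 1) * (e - 1) - (h * 2) * (h * 2) * (X * X * e)"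
    by (simp add: h)
  also have "\<dots> = (k * (e - 1)) * (e - 1) - (k * (e - 1)) * (k * (e - 1)) + h * h * (X * X) * ((e - 1) * (e - 1))"
    unfolding k by (simp add: algebra_simps)
  also have "\<dots> = (k - k\<^sup>2 + h * h * X\<^sup>2) * (e - 1)\<^sup>2"
    by (simp add: algebra_simps power2_eq_square)
  finally show "X * d * (e - 1)\<^sup>2 = (k - k\<^sup>2 + h * h * X\<^sup>2) * (e - 1)\<^sup>2" .
qed

text \<open>Differentiate \<open>kappa_even * (e - 1) = z/2 * (e + 1)\<close> with
  \<open>e = exp z\<close> and eliminate \<open>e\<close>; the factor \<open>(e - 1)^2\<close>
  cancels because real power series have no zero divisors.\<close>

lemma kappa_even_riccati:
  "fps_X * fps_deriv kappa_even = kappa_even - kappa_even ^ 2 + fps_const (1/4) * fps_X ^ 2"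
proof -
  define e where "e = (fps_exp 1 :: real fps)"
  define h where "h = (fps_const (1/2) :: real fps)"
  have de: "fps_deriv e = e" "fps_deriv h = 0" by (simp_all add: e_def h_def)
  have h: "h * 2 = 1" "fps_const (1/4) = h * h"
    by (simp_all add: h_def numeral_fps_const)
  have "kappa * (e - 1) = fps_X * e"
    using kappa_mult_expm1 by (simp add: e_def)
  then have 1: "kappa_even * (e - 1) = h * fps_X * (e + 1)"
    unfolding kappa_even_def h_def[symmetric] using riccati_aux(1)[OF h(1)] by blast
  have "fps_deriv (kappa_even * (e - 1)) = fps_deriv (h * fps_X * (e + 1))"
    by (simp add: 1)
  then have "fps_deriv kappa_even * (e - 1) = h * (e + 1) + h * fps_X * e - kappa_even * e"
    by (simp add: de algebra_simps)
  with 1 h(1) have "fps_X * fps_deriv kappa_even * (e - 1)\<^sup>2 =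
      (kappa_even - kappa_even ^ 2 + h * h * fps_X ^ 2) * (e - 1)\<^sup>2"
    using riccati_aux(2)[OF h(1)] by blast
  then have "fps_X * fps_deriv kappa_even * (e - 1)\<^sup>2 =
      (kappa_even - kappa_even ^ 2 + fps_const (1/4) * fps_X ^ 2) * (e - 1)\<^sup>2"
    by (simp only: h(2))
  moreover have "e - 1 \<noteq> 0"
  proof
    assume "e - 1 = 0"
    then have "(e - 1) $ 1 = 0" by simp
    then show False by (simp add: e_def)
  qed
  ultimately show ?thesis by simp
qed

lemma kappa_even_0: "kappa_even $ 0 = 1"
  by (simp add: kappa_even_def kappa_def fps_expm1_quot_def)

text \<open>Compare coefficients in the Riccati equation. The terms \<open>i = 0\<close> and
  \<open>i = n\<close> of the square, with the linear term, change the factor \<open>n\<close> on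
  the left into \<open>n + 1\<close>.\<close>

lemma kappa_even_rec:
  assumes "n \<ge> 1"
  shows "real (n + 1) * kappa_even $ n = (if n = 2 then 1/4 else 0) - (\<Sum>i=1..<n. kappa_even $ i * kappa_even $ (n - i))"
proof -
  obtain m where m: "n = Suc m" using assms by (cases n) auto
  have "(kappa_even ^ 2) $ n = (\<Sum>i=0..n. kappa_even $ i * kappa_even $ (n - i))"
    by (simp add: power2_eq_square fps_mult_nth)
  also have "\<dots> = 2 * kappa_even $ n + (\<Sum>i=1..<n. kappa_even $ i * kappa_even $ (n - i))"
    using assms unfolding m
    by (simp add: sum.atLeast_Suc_atMost sum.atLeastLessThan_Suc atLeastLessThanSuc_atLeastAtMost[symmetric] kappa_even_0 sum.atLeast_Suc_lessThan)
  finally have sq: "(kappa_even ^ 2) $ n = \<dots>" .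
  have "(fps_X * fps_deriv kappa_even) $ n = real n * kappa_even $ n"
    by (simp add: m)
  then show ?thesis
    unfolding kappa_even_riccati using sq
    by (auto simp: algebra_simps fps_X_power_nth)
qed

text \<open>Since the odd coefficients vanish, the signs \<open>- (- 1) ^ (n div 2)\<close> turn the Riccati recursion
  into one without cancellation.\<close>

lemma kappa_even_odd: "odd n \<Longrightarrow> kappa_even $ n = 0"
proof (induction n rule: less_induct)
  case (less n)
  then have n: "n \<ge> 1" "n \<noteq> 2" by (auto intro: Suc_leI odd_pos)
  have "kappa_even $ i * kappa_even $ (n - i) = 0" if "i \<in> {1..<n}" for i
    using that less.prems less.IH[of i] less.IH[of "n - i"] by (cases "odd i") auto
  then show ?case
    using kappa_even_rec[OF n(1)] n(2) by (simp add: sum.neutral)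
qed

text \<open>For even \<open>n\<close> and \<open>i\<close> the exponents \<open>i div 2\<close> and
  \<open>(n - i) div 2\<close> add up to \<open>n div 2\<close>, so the products have the sign
  opposite to the one in \<open>r n\<close>, and the minus in \<open>kappa_even_rec\<close> becomes
  a plus. Products with an odd index vanish.\<close>

lemma kappa_even_signed_rec:
  fixes r :: "nat \<Rightarrow> real"
  defines "r \<equiv> \<lambda>n. - ((- 1) ^ (n div 2)) * kappa_even $ n"
  assumes "n \<ge> 1"
  shows "real (n + 1) * r n = (if n = 2 then 1/4 else 0) + (\<Sum>i=1..<n. r i * r (n - i))"
proof (cases "odd n")
  case True
  have "r i * r (n - i) = 0" if "i \<in> {1..<n}" for i
    using that True kappa_even_odd[of i] kappa_even_odd[of "n - i"] by (cases "odd i") (auto simp: r_def)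
  then have "(\<Sum>i=1..<n. r i * r (n - i)) = 0" by (intro sum.neutral) blast
  then show ?thesis using True by (auto simp: r_def kappa_even_odd)
next
  case False
  have "r i * r (n - i) = (-1) ^ (n div 2) * (kappa_even $ i * kappa_even $ (n - i))"
    if i: "i \<in> {1..<n}" for i
  proof (cases "odd i")
    case True
    then show ?thesis by (simp add: r_def kappa_even_odd)
  next
    case even: False
    have "i div 2 + (n - i) div 2 = n div 2"
      using i even False by (auto elim!: evenE) 
    then show ?thesis by (simp add: r_def power_add[symmetric])
  qed
  then have "(\<Sum>i=1..<n. r i * r (n - i)) = (-1) ^ (n div 2) * (\<Sum>i=1..<n. kappa_even $ i * kappa_even $ (n - i))"
    by (simp add: sum_distrib_left)
  also have "\<dots> = (-1) ^ (n div 2) * ((if n = 2 then 1/4 else 0) - real (n + 1) * kappa_even $ n)"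
    using kappa_even_rec[OF assms(2)] by simp
  finally have sum: "(\<Sum>i=1..<n. r i * r (n - i)) = \<dots>" .
  have "r n = - ((- 1) ^ (n div 2)) * kappa_even $ n" by (simp add: r_def)
  then show ?thesis unfolding sum by (auto simp: algebra_simps)
qed

text \<open>The signed recursion only adds products of earlier terms, so by induction the signed
  coefficients are nonnegative.\<close>

lemma abs_kappa_even:
  assumes "n \<ge> 1"
  shows "\<bar>kappa_even $ n\<bar> = - ((- 1) ^ (n div 2)) * kappa_even $ n"
proof -
  define r where "r n = - ((- 1) ^ (n div 2)) * kappa_even $ n" for n
  have "r n \<ge> 0" using assms
  proof (induction n rule: less_induct)
    case (less n)
    have "real (n + 1) * r n = (if n = 2 then 1/4 else 0) + (\<Sum>i=1..<n. r i * r (n - i))"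
      using kappa_even_signed_rec[OF less.prems] by (simp add: r_def)
    also have "\<dots> \<ge> 0"
      using less.IH by (auto intro!: add_nonneg_nonneg sum_nonneg mult_nonneg_nonneg)
    finally show ?case by (simp add: zero_le_mult_iff)
  qed
  moreover have "\<bar>r n\<bar> = \<bar>kappa_even $ n\<bar>"
    by (simp add: r_def abs_mult)
  ultimately show ?thesis by (simp add: r_def)
qed

lemma abs_kappa_even_rec:
  assumes "n \<ge> 1"
  shows "real (n + 1) * \<bar>kappa_even $ n\<bar> =
    (if n = 2 then 1/4 else 0) + (\<Sum>i=1..<n. \<bar>kappa_even $ i\<bar> * \<bar>kappa_even $ (n - i)\<bar>)"
proof -
  have "(\<Sum>i=1..<n. \<bar>kappa_even $ i\<bar> * \<bar>kappa_even $ (n - i)\<bar>) =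
      (\<Sum>i=1..<n. (- ((- 1) ^ (i div 2)) * kappa_even $ i) * (- ((- 1) ^ ((n - i) div 2)) * kappa_even $ (n - i)))"
    by (intro sum.cong refl arg_cong2[where f = "(*)"] abs_kappa_even) auto
  then show ?thesis
    unfolding abs_kappa_even[OF assms] by (simp only: kappa_even_signed_rec[OF assms])
qed

section \<open>Bounding the partial sums by \<open>Gfun\<close>\<close>

lemma kappa_even_partial_riccati:
  fixes u :: real and N :: nat
  defines "P \<equiv> \<Sum>n=1..N. \<bar>kappa_even $ n\<bar> * u ^ n"
  assumes "u \<ge> 0"
  shows "(\<Sum>n=1..N. real n * \<bar>kappa_even $ n\<bar> * u ^ n) \<le> P ^ 2 - P + u ^ 2 / 4"
proof -
  define r where "r n = \<bar>kappa_even $ n\<bar>" for n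
  have "(\<Sum>n=1..N. real n * r n * u ^ n) + P =
     (\<Sum>n=1..N. real (n + 1) * r n * u ^ n)"
    by (simp add: P_def r_def sum.distrib[symmetric] algebra_simps)
  also have "\<dots> = (\<Sum>n=1..N. (if n = 2 then u ^ 2 / 4 else 0) + (\<Sum>i=1..<n. (r i * u ^ i) * (r (n - i) * u ^ (n - i))))"
  proof (intro sum.cong refl)
    fix n assume n: "n \<in> {1..N}"
    have "(\<Sum>i=1..<n. (r i * u ^ i) * (r (n - i) * u ^ (n - i))) = (\<Sum>i=1..<n. r i * r (n - i)) * u ^ n"
      unfolding sum_distrib_right
    proof (intro sum.cong refl)
      fix i assume "i \<in> {1..<n}"
      then have "u ^ n = u ^ i * u ^ (n - i)" by (simp add: power_add[symmetric])
      then show "(r i * u ^ i) * (r (n - i) * u ^ (n - i)) = r i * r (n - i) * u ^ n" by simp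
    qed
    then show "real (n + 1) * r n * u ^ n = (if n = 2 then u ^ 2 / 4 else 0) + (\<Sum>i=1..<n. (r i * u ^ i) * (r (n - i) * u ^ (n - i)))"
      using abs_kappa_even_rec[of n] n by (simp add: r_def algebra_simps)
  qed
  also have "\<dots> = (if 2 \<le> N then u ^ 2 / 4 else 0) + (\<Sum>n=1..N. \<Sum>i=1..<n. (r i * u ^ i) * (r (n - i) * u ^ (n - i)))"
    by (simp add: sum.distrib)
  \<comment> \<open>Truncation loses the products with \<open>i + j > N\<close> of the square; all
    terms are nonnegative, so the Riccati equation becomes an inequality.\<close>
  also have "\<dots> \<le> u ^ 2 / 4 + P ^ 2"
  proof (intro add_mono)
    have "(\<Sum>n=1..N. \<Sum>i=1..<n. (r i * u ^ i) * (r (n - i) * u ^ (n - i))) =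
       (\<Sum>(n, i)\<in>(SIGMA n:{1..N}. {1..<n}). (r i * u ^ i) * (r (n - i) * u ^ (n - i)))"
      by (simp add: sum.Sigma)
    also have "\<dots> = (\<Sum>(i, j)\<in>{(i, j). 1 \<le> i \<and> 1 \<le> j \<and> i + j \<le> N}. (r i * u ^ i) * (r j * u ^ j))"
      by (rule sum.reindex_bij_witness[of _ "\<lambda>(i, j). (i + j, i)" "\<lambda>(n, i). (i, n - i)"]) auto
    also have "\<dots> \<le> (\<Sum>(i, j)\<in>{1..N} \<times> {1..N}. (r i * u ^ i) * (r j * u ^ j))"
      using assms(2) by (intro sum_mono2) (auto simp: r_def)
    also have "\<dots> = P ^ 2"
      by (simp add: P_def r_def power2_eq_square sum_product sum.cartesian_product)
    finally show "(\<Sum>n=1..N. \<Sum>i=1..<n. (r i * u ^ i) * (r (n - i) * u ^ (n - i))) \<le> P ^ 2" .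
  qed simp
  finally show ?thesis by (simp add: r_def)
qed

text \<open>The right side solves \<open>x * w' = w^2 - w + x^2 / 4\<close>, of which the partial
  sum is a subsolution. Their difference times \<open>sin (x / 2)\<close> is \<open>V\<close>; it
  satisfies the linear inequality \<open>x * V' \<ge> P * V\<close> with \<open>V 0 = 0\<close>, and
  an integrating factor gives \<open>V \<ge> 0\<close>.\<close>

lemma kappa_even_partial_le:
  fixes u :: real and N :: nat
  assumes u: "0 < u" "u < 2 * pi"
  shows "(\<Sum>n=1..N. \<bar>kappa_even $ n\<bar> * u ^ n) \<le> 1 - u / 2 * cot (u / 2)"
proof -
  define r where "r n = \<bar>kappa_even $ n\<bar>" for n
  define P where "P x = (\<Sum>n=1..N. r n * x ^ n)" for x
  define P' where "P' x = (\<Sum>n=1..N. real n * r n * x ^ (n - 1))" for x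
  \<comment> \<open>\<open>Q\<close> is the antiderivative of \<open>P x / x\<close>, written as a
    polynomial so that nothing is divided by \<open>x\<close> at 0; \<open>exp (- Q x)\<close> is
    the integrating factor.\<close>
  define Q where "Q x = (\<Sum>n=1..N. r n * x ^ n / n)" for x
  define q where "q x = (\<Sum>n=1..N. r n * x ^ (n - 1))" for x
  have dP: "(P has_real_derivative P' x) (at x)" for x
    unfolding P_def P'_def by (auto intro!: derivative_eq_intros sum.cong)
  have dQ: "(Q has_real_derivative q x) (at x)" for x
    unfolding Q_def q_def by (auto intro!: derivative_eq_intros sum.cong)
  have xq: "x * q x = P x" for x
    unfolding P_def q_def sum_distrib_left
    by (intro sum.cong refl) (auto simp: power_eq_if)
  have xP': "x * P' x = (\<Sum>n=1..N. real n * r n * x ^ n)" for x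
    unfolding P'_def sum_distrib_left
    by (intro sum.cong refl) (auto simp: power_eq_if)
  define V where "V x = sin (x/2) * (1 - P x) - x/2 * cos (x/2)" for x
  define V' where "V' x = - (1/2) * cos (x/2) * P x - sin (x/2) * P' x + x/4 * sin (x/2)" for x
  have dV: "(V has_real_derivative V' x) (at x)" for x
    unfolding V_def V'_def by (auto intro!: derivative_eq_intros dP simp: algebra_simps diff_divide_distrib)
  have "V 0 * exp (- Q 0) \<le> V u * exp (- Q u)"
  proof (rule DERIV_nonneg_imp_increasing_open[where f = "\<lambda>x. V x * exp (- Q x)"])
    fix x assume x: "0 < x" "x < u"
    have "x * V' x = - (x/2) * cos (x/2) * P x + sin (x/2) * (x\<^sup>2/4 - x * P' x)"
      by (simp add: V'_def algebra_simps power2_eq_square)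
    also have "\<dots> \<ge> - (x/2) * cos (x/2) * P x + sin (x/2) * (P x - (P x)\<^sup>2)"
    proof -
      have "sin (x/2) \<ge> 0" using x u by (intro sin_ge_zero) auto
      moreover have "P x - (P x)\<^sup>2 \<le> x\<^sup>2/4 - x * P' x"
        using kappa_even_partial_riccati[of x N] x unfolding xP' by (simp add: P_def r_def)
      ultimately show ?thesis by (intro add_left_mono mult_left_mono)
    qed
    also have "- (x/2) * cos (x/2) * P x + sin (x/2) * (P x - (P x)\<^sup>2) = P x * V x"
      by (simp add: V_def algebra_simps power2_eq_square)
    finally have "P x * V x \<le> x * V' x" .
    moreover have "x * (V' x - q x * V x) = x * V' x - P x * V x"
      unfolding xq[symmetric] by (simp add: algebra_simps)
    ultimately have "x * (V' x - q x * V x) \<ge> 0"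
      by simp
    then have "V' x - q x * V x \<ge> 0"
      using x by (simp add: zero_le_mult_iff)
    moreover have "((\<lambda>x. V x * exp (- Q x)) has_real_derivative (V' x - q x * V x) * exp (- Q x)) (at x)"
      by (auto intro!: derivative_eq_intros dV dQ simp: algebra_simps)
    ultimately show "\<exists>y. ((\<lambda>x. V x * exp (- Q x)) has_real_derivative y) (at x) \<and> 0 \<le> y"
      by (intro exI[of _ "(V' x - q x * V x) * exp (- Q x)"] conjI) auto
  next
    have "continuous_on {0..u} V" "continuous_on {0..u} Q"
      using dV dQ by (auto intro!: continuous_at_imp_continuous_on DERIV_isCont)
    then show "continuous_on {0..u} (\<lambda>x. V x * exp (- Q x))"
      by (intro continuous_intros)
  qed (use u in auto)
  then have "V u \<ge> 0"
    by (simp add: V_def zero_le_mult_iff)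
  moreover have "sin (u/2) > 0"
    using u by (intro sin_gt_zero) auto
  ultimately have "P u \<le> 1 - u / 2 * cot (u/2)"
    unfolding V_def cot_def by (simp add: field_simps)
  then show ?thesis by (simp add: P_def r_def)
qed

text \<open>\<open>kappa\<close> and \<open>kappa_even\<close> differ only at \<open>n = 1\<close>,
  by \<open>1/2\<close>; this contributes the summand \<open>u / 2\<close> of
  \<open>Gfun u\<close>.\<close>

lemma abs_kappa_partial_le_Gfun:
  fixes u :: real
  assumes u: "0 \<le> u" "u < 2 * pi"
  shows "(\<Sum>n\<le>N. \<bar>kappa $ n\<bar> * u ^ n) \<le> Gfun u"
proof (cases "u = 0")
  case True
  have "(\<Sum>n\<le>N. \<bar>kappa $ n\<bar> * u ^ n) = (\<Sum>n\<le>N. if n = 0 then \<bar>kappa $ n\<bar> else 0)"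
    using True by (intro sum.cong) auto
  also have "\<dots> = 1" by (simp add: kappa_def fps_expm1_quot_def)
  finally show ?thesis using True by (simp add: Gfun_def)
next
  case False
  have k0: "\<bar>kappa $ 0\<bar> = 1" by (simp add: kappa_def fps_expm1_quot_def)
  have k: "\<bar>kappa $ n\<bar> \<le> \<bar>kappa_even $ n\<bar> + (if n = 1 then 1/2 else 0)" for n
    by (auto simp: kappa_even_def)
  have "(\<Sum>n\<le>N. \<bar>kappa $ n\<bar> * u ^ n) = \<bar>kappa $ 0\<bar> * u ^ 0 + (\<Sum>n=1..N. \<bar>kappa $ n\<bar> * u ^ n)"
    by (simp add: atMost_atLeast0 sum.atLeast_Suc_atMost)
  also have "\<dots> \<le> 1 + (\<Sum>n=1..N. (\<bar>kappa_even $ n\<bar> + (if n = 1 then 1/2 else 0)) * u ^ n)"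
    using u k by (intro add_mono sum_mono mult_right_mono) (auto simp: k0)
  also have "\<dots> = 1 + (\<Sum>n=1..N. \<bar>kappa_even $ n\<bar> * u ^ n) + (\<Sum>n=1..N. if n = 1 then u / 2 else 0)"
    unfolding add.assoc sum.distrib[symmetric]
    by (intro arg_cong2[where f = "(+)"] sum.cong refl) (simp add: algebra_simps)
  also have "\<dots> \<le> 1 + (1 - u / 2 * cot (u / 2)) + u / 2"
    using kappa_even_partial_le[of u N] u False by (intro add_mono) auto
  also have "\<dots> = Gfun u"
    using False by (simp add: Gfun_def algebra_simps)
  finally show ?thesis .
qed

lemma Gfun_ge_1: "0 \<le> u \<Longrightarrow> u < 2 * pi \<Longrightarrow> Gfun u \<ge> 1"
  using abs_kappa_partial_le_Gfun[of u 0] by (simp add: kappa_def fps_expm1_quot_def)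

lemma continuous_on_Gfun: "continuous_on {0..<2 * pi} Gfun"
proof -
  have *: "isCont Gfun u" if "0 < u" "u < 2 * pi" for u
  proof -
    have "sin (u / 2) \<noteq> 0" using that sin_gt_zero[of "u / 2"] by auto
    then have "isCont (\<lambda>u. 2 + u / 2 * (1 - cot (u / 2))) u"
      by (auto intro!: continuous_intros isCont_cot')
    moreover have "eventually (\<lambda>x. x \<in> {0<..<2*pi}) (nhds u)"
      using that by (intro eventually_nhds_in_open) auto
    then have "eventually (\<lambda>x. Gfun x = 2 + x / 2 * (1 - cot (x / 2))) (nhds u)"
      by eventually_elim (auto simp: Gfun_def)
    ultimately show ?thesis by (subst isCont_cong)
  qed
  \<comment> \<open>At 0 the singularity is removed by
    \<open>u/2 * cot (u/2) = (u/2) / sin (u/2) * cos (u/2)\<close>, whose first factor tends to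
    1.\<close>
  have "((\<lambda>u::real. 2 + u / 2 - (u / 2) / sin (u / 2) * cos (u / 2)) \<longlongrightarrow> 2 + 0 / 2 - 1 * cos (0/2)) (at 0)"
  proof (intro tendsto_intros)
    have "((\<lambda>x::real. sin x / x) \<longlongrightarrow> 1) (at 0)"
      using DERIV_sin[of 0] by (simp add: DERIV_def)
    then have "((\<lambda>x::real. sin (x/2) / (x/2)) \<longlongrightarrow> 1) (at 0)"
      by (rule filterlim_compose[of _ _ "at 0"])
        (auto simp: filterlim_at eventually_at_filter intro!: tendsto_eq_intros)
    from tendsto_inverse[OF this] show "((\<lambda>x::real. (x/2) / sin (x/2)) \<longlongrightarrow> 1) (at 0)"
      by (simp add: mult.commute)
  qed simp_all
  then have "((\<lambda>u::real. 2 + u / 2 - (u / 2) / sin (u / 2) * cos (u / 2)) \<longlongrightarrow> Gfun 0) (at 0)"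
    by (simp add: Gfun_def)
  then have "(Gfun \<longlongrightarrow> Gfun 0) (at 0)"
    by (rule Lim_transform_eventually)
      (auto simp: eventually_at_filter Gfun_def cot_def algebra_simps)
  then have "isCont Gfun 0" by (simp add: isCont_def)
  with * have "isCont Gfun u" if "u \<in> {0..<2 * pi}" for u
    using that by (cases "u = 0") auto
  then show ?thesis by (intro continuous_at_imp_continuous_on) auto
qed

section \<open>Series in two non-commuting indeterminates\<close>

typedef ncs = "UNIV :: ncpoly set" morphisms coef Ncs ..

lemma coef_Ncs [simp]: "coef (Ncs f) = f"
  by (simp add: Ncs_inverse)

lemma ncs_eqI: "(\<And>w. coef p w = coef q w) \<Longrightarrow> p = q"
  by (metis coef_inverse ext)

lemma pmult_assoc: "pmult (pmult p q) r = pmult p (pmult q r)"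
proof
  fix w
  have "pmult (pmult p q) r w =
      (\<Sum>(k, l)\<in>(SIGMA k:{..length w}. {..k}). p (take l w) * q (drop l (take k w)) * r (drop k w))"
    unfolding pmult_def sum_distrib_right
    by (subst sum.Sigma[symmetric]) (auto intro!: sum.cong simp: min_absorb1 min_absorb2)
  also have "\<dots> = (\<Sum>(l, m)\<in>(SIGMA l:{..length w}. {..length w - l}).
      p (take l w) * q (take m (drop l w)) * r (drop m (drop l w)))"
    by (rule sum.reindex_bij_witness[of _ "\<lambda>(l, m). (l + m, l)" "\<lambda>(k, l). (l, k - l)"])
      (auto simp: drop_take)
  also have "\<dots> = pmult p (pmult q r) w"
    by (simp add: pmult_def sum_distrib_left sum.Sigma mult.assoc)
  finally show "pmult (pmult p q) r w = pmult p (pmult q r) w" .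
qed

instantiation ncs :: real_algebra_1
begin

definition "0 = Ncs (\<lambda>w. 0)"
definition "1 = Ncs (\<lambda>w. if w = [] then 1 else 0)"
definition "p + q = Ncs (padd (coef p) (coef q))"
definition "- p = Ncs (\<lambda>w. - coef p w)"
definition "p - q = Ncs (\<lambda>w. coef p w - coef q w)"
definition "p * q = Ncs (pmult (coef p) (coef q))"
definition "c *\<^sub>R p = Ncs (psmult c (coef p))"

instance
proof
  fix p q r :: ncs and c d :: real
  note defs = zero_ncs_def one_ncs_def plus_ncs_def uminus_ncs_def minus_ncs_def times_ncs_def
    scaleR_ncs_def padd_def psmult_def
  show "p * q * r = p * (q * r)"
    by (simp add: times_ncs_def pmult_assoc)
  have "(\<Sum>k\<le>length w. (if take k w = [] then 1 else 0) * f (drop k w)) = f w"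
    for w :: "gen list" and f :: ncpoly
    by (subst sum.remove[of _ 0]) (auto intro!: sum.neutral)
  then show "1 * p = p"
    by (intro ncs_eqI) (simp add: defs pmult_def)
  have "(\<Sum>k\<le>length w. f (take k w) * (if drop k w = [] then 1 else 0)) = f w"
    for w :: "gen list" and f :: ncpoly
    by (subst sum.remove[of _ "length w"]) (auto intro!: sum.neutral)
  then show "p * 1 = p"
    by (intro ncs_eqI) (simp add: defs pmult_def)
  show "(0::ncs) \<noteq> 1"
  proof
    assume "(0::ncs) = 1"
    then have "coef 0 [] = coef 1 []" by simp
    then show False by (simp add: defs)
  qed
qed (auto intro!: ncs_eqI simp: zero_ncs_def plus_ncs_def uminus_ncs_def minus_ncs_def times_ncs_def
    scaleR_ncs_def padd_def psmult_def pmult_def algebra_simps sum.distrib sum_distrib_left)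

end

lemma coef_0 [simp]: "coef 0 w = 0"
  and coef_1: "coef 1 w = (if w = [] then 1 else 0)"
  and coef_add [simp]: "coef (p + q) w = coef p w + coef q w"
  and coef_minus [simp]: "coef (- p) w = - coef p w"
  and coef_diff [simp]: "coef (p - q) w = coef p w - coef q w"
  and coef_scaleR [simp]: "coef (c *\<^sub>R p) w = c * coef p w"
  and coef_mult: "coef (p * q) w = (\<Sum>k\<le>length w. coef p (take k w) * coef q (drop k w))"
  by (simp_all add: zero_ncs_def one_ncs_def plus_ncs_def uminus_ncs_def minus_ncs_def
      scaleR_ncs_def times_ncs_def padd_def psmult_def pmult_def)

lemma coef_sum [simp]: "coef (sum f A) w = (\<Sum>x\<in>A. coef (f x) w)"
  by (induction A rule: infinite_finite_induct) auto

lemma coef_fun_ops: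
  "coef (p + q) = padd (coef p) (coef q)" "coef (c *\<^sub>R p) = psmult c (coef p)"
  "coef (p * q - q * p) = pbr (coef p) (coef q)"
  by (simp_all add: plus_ncs_def scaleR_ncs_def pbr_def minus_ncs_def times_ncs_def)

section \<open>Congruence of series up to a given word length\<close>

definition agree :: "nat \<Rightarrow> ncs \<Rightarrow> ncs \<Rightarrow> bool" where
  "agree n p q \<longleftrightarrow> (\<forall>w. length w < n \<longrightarrow> coef p w = coef q w)"

lemma agree_refl [simp]: "agree n p p"
  and agree_sym: "agree n p q \<Longrightarrow> agree n q p"
  and agree_trans [trans]: "agree n p q \<Longrightarrow> agree n q r \<Longrightarrow> agree n p r"
  and agree_mono: "agree n p q \<Longrightarrow> m \<le> n \<Longrightarrow> agree m p q"
  and agree_0_left [simp]: "agree 0 p q"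
  and agree_diff_0: "agree n (p - q) 0 \<longleftrightarrow> agree n p q"
  by (auto simp: agree_def)

lemma agree_add: "agree n p q \<Longrightarrow> agree n p' q' \<Longrightarrow> agree n (p + p') (q + q')"
  and agree_diff: "agree n p q \<Longrightarrow> agree n p' q' \<Longrightarrow> agree n (p - p') (q - q')"
  and agree_scaleR: "agree n p q \<Longrightarrow> agree n (c *\<^sub>R p) (c *\<^sub>R q)"
  by (auto simp: agree_def)

lemma agree_sum: "(\<And>x. x \<in> A \<Longrightarrow> agree n (f x) (g x)) \<Longrightarrow> agree n (sum f A) (sum g A)"
  by (auto simp: agree_def)

lemma agree_imp_eq: "(\<And>n. agree (Suc n) p q) \<Longrightarrow> p = q"
  by (rule ncs_eqI) (auto simp: agree_def)

lemma agree_mult_0: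
  assumes "agree m p 0" "agree n q 0"
  shows "agree (m + n) (p * q) 0"
  unfolding agree_def
proof (intro allI impI)
  fix w :: "gen list" assume w: "length w < m + n"
  have "coef p (take k w) * coef q (drop k w) = 0" for k
    using assms w unfolding agree_def by (cases "length (take k w) < m") auto
  then show "coef (p * q) w = coef 0 w"
    by (simp add: coef_mult sum.neutral)
qed

lemma agree_mult:
  assumes "agree n p p'" "agree n q q'"
  shows "agree n (p * q) (p' * q')"
proof -
  have "agree (n + 0) ((p - p') * q) 0" "agree (0 + n) (p' * (q - q')) 0"
    by (rule agree_mult_0; use assms in \<open>simp add: agree_diff_0\<close>)+
  from agree_add[OF this[simplified]] show ?thesis
    by (subst agree_diff_0[symmetric]) (simp add: algebra_simps)
qed

section \<open>Power series in operators that raise the degree\<close>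

definition raising :: "(ncs \<Rightarrow> ncs) \<Rightarrow> bool" where
  "raising T \<longleftrightarrow> linear T \<and> (\<forall>n p. agree n p 0 \<longrightarrow> agree (Suc n) (T p) 0)"

lemma raising_pow:
  assumes "raising T"
  shows "linear (T ^^ k)" and "agree n p 0 \<Longrightarrow> agree (n + k) ((T ^^ k) p) 0"
proof -
  show "linear (T ^^ k)"
    using assms by (induction k) (auto simp: raising_def linear_iff)
  show "agree (n + k) ((T ^^ k) p) 0" if "agree n p 0"
    using assms that by (induction k) (auto simp: raising_def)
qed

lemma raising_pow_agree:
  assumes "raising T" "agree n p q"
  shows "agree n ((T ^^ k) p) ((T ^^ k) q)"
proof -
  have "agree (n + k) ((T ^^ k) (p - q)) 0"
    using assms by (intro raising_pow) (simp_all add: agree_diff_0)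
  then show ?thesis
    using linear_diff[OF raising_pow(1)[OF assms(1)]] by (metis agree_diff_0 agree_mono le_add1)
qed

definition opser :: "real fps \<Rightarrow> (ncs \<Rightarrow> ncs) \<Rightarrow> ncs \<Rightarrow> ncs" where
  "opser F T p = Ncs (\<lambda>w. \<Sum>n\<le>length w. F $ n * coef ((T ^^ n) p) w)"

text \<open>Reduces identities between operator series to identities between polynomials in
  \<open>T\<close>, checked up to each word length.\<close>

lemma opser_agree_sum:
  assumes "raising T"
  shows "agree (Suc N) (opser F T p) (\<Sum>n\<le>N. (F $ n) *\<^sub>R (T ^^ n) p)"
  unfolding agree_def
proof (intro allI impI)
  fix w :: "gen list" assume w: "length w < Suc N"
  have "coef ((T ^^ n) p) w = 0" if "n > length w" for n
    using raising_pow(2)[OF assms, of 0 p n] that by (simp add: agree_def)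
  then show "coef (opser F T p) w = coef (\<Sum>n\<le>N. (F $ n) *\<^sub>R (T ^^ n) p) w"
    using w by (simp add: opser_def) (rule sum.mono_neutral_left, auto)
qed

lemma opser_eqI:
  assumes "raising T" "\<And>N. agree (Suc N) q (\<Sum>n\<le>N. (F $ n) *\<^sub>R (T ^^ n) p)"
  shows "opser F T p = q"
  by (rule agree_imp_eq) (meson agree_sym agree_trans assms opser_agree_sum)

lemma linear_opser:
  assumes "raising T"
  shows "linear (opser F T)"
  by (intro linearI ncs_eqI)
    (simp_all add: opser_def linear_add[OF raising_pow(1)[OF assms]] linear_cmul[OF raising_pow(1)[OF assms]]
      algebra_simps sum.distrib sum_distrib_left)

lemma raising_opser:
  assumes "raising T" "F $ 0 = 0"
  shows "raising (opser F T)"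
  unfolding raising_def
proof (intro conjI allI impI)
  show "linear (opser F T)" by (rule linear_opser[OF assms(1)])
  fix n p assume p: "agree n p 0"
  have "F $ k * coef ((T ^^ k) p) w = 0" if "length w < Suc n" for k w
    using raising_pow(2)[OF assms(1) p, of k] that assms(2) by (cases k) (auto simp: agree_def)
  then show "agree (Suc n) (opser F T p) 0"
    unfolding agree_def opser_def by (auto intro!: sum.neutral)
qed

lemma sum_square_eq_triangle:
  fixes f :: "nat \<Rightarrow> nat \<Rightarrow> real"
  assumes "\<And>i j. i + j > N \<Longrightarrow> f i j = 0"
  shows "(\<Sum>i\<le>N. \<Sum>j\<le>N. f i j) = (\<Sum>k\<le>N. \<Sum>i\<le>k. f i (k - i))"
proof -
  have "(\<Sum>i\<le>N. \<Sum>j\<le>N. f i j) = (\<Sum>(i, j)\<in>{..N} \<times> {..N}. f i j)"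
    by (simp add: sum.cartesian_product)
  also have "\<dots> = (\<Sum>(i, j)\<in>{(i, j). i + j \<le> N}. f i j)"
    by (intro sum.mono_neutral_right) (auto, meson assms not_le)
  also have "\<dots> = (\<Sum>k\<le>N. \<Sum>i\<le>k. f i (k - i))"
    by (rule sum.triangle_reindex_eq)
  finally show ?thesis .
qed

text \<open>A Cauchy product: the terms of order \<open>n + m > N\<close> vanish on words of length
  at most \<open>N\<close>.\<close>

lemma opser_mult:
  assumes T: "raising T"
  shows "opser (F * G) T p = opser F T (opser G T p)"
proof (rule opser_eqI[OF T])
  fix N
  have "agree (Suc N) (opser F T (opser G T p)) (\<Sum>n\<le>N. (F $ n) *\<^sub>R (T ^^ n) (opser G T p))"
    by (rule opser_agree_sum[OF T])
  also have "agree (Suc N) \<dots> (\<Sum>n\<le>N. (F $ n) *\<^sub>R (T ^^ n) (\<Sum>m\<le>N. (G $ m) *\<^sub>R (T ^^ m) p))"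
    by (intro agree_sum agree_scaleR raising_pow_agree T opser_agree_sum)
  also have "\<dots> = (\<Sum>n\<le>N. \<Sum>m\<le>N. (F $ n * G $ m) *\<^sub>R (T ^^ (n + m)) p)"
    by (simp add: linear_sum[OF raising_pow(1)[OF T]] linear_cmul[OF raising_pow(1)[OF T]]
        scaleR_sum_right funpow_add)
  also have "agree (Suc N) \<dots> (\<Sum>k\<le>N. ((F * G) $ k) *\<^sub>R (T ^^ k) p)"
    unfolding agree_def
  proof (intro allI impI)
    fix w :: "gen list" assume w: "length w < Suc N"
    have "coef ((T ^^ k) p) w = 0" if "k > N" for k
      using raising_pow(2)[OF T, of 0 p k] that w by (simp add: agree_def)
    then have "(\<Sum>n\<le>N. \<Sum>m\<le>N. F $ n * G $ m * coef ((T ^^ (n + m)) p) w) =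
        (\<Sum>k\<le>N. \<Sum>n\<le>k. F $ n * G $ (k - n) * coef ((T ^^ (n + (k - n))) p) w)"
      by (intro sum_square_eq_triangle) auto
    then show "coef (\<Sum>n\<le>N. \<Sum>m\<le>N. (F $ n * G $ m) *\<^sub>R (T ^^ (n + m)) p) w =
        coef (\<Sum>k\<le>N. ((F * G) $ k) *\<^sub>R (T ^^ k) p) w"
      by (simp add: fps_mult_nth sum_distrib_right atMost_atLeast0)
  qed
  finally show "agree (Suc N) (opser F T (opser G T p)) (\<Sum>k\<le>N. ((F * G) $ k) *\<^sub>R (T ^^ k) p)" .
qed

lemma opser_1: "raising T \<Longrightarrow> opser 1 T p = p"
  by (rule opser_eqI) (simp_all add: if_distrib[of "\<lambda>c. c *\<^sub>R _"] sum.If_cases cong: if_cong)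

lemma opser_1_plus_X:
  assumes "raising T"
  shows "opser (1 + fps_X) T p = p + T p"
proof (rule ncs_eqI)
  fix w :: "gen list"
  have "agree (Suc (length w + 1)) (opser (1 + fps_X) T p) (\<Sum>n\<le>length w + 1. ((1 + fps_X) $ n) *\<^sub>R (T ^^ n) p)"
    by (rule opser_agree_sum[OF assms])
  also have "(\<Sum>n\<le>length w + 1. ((1 + fps_X) $ n) *\<^sub>R (T ^^ n) p) = 
     (\<Sum>n\<le>length w + 1. (if n = 0 then p else 0) + (if n = 1 then T p else 0))"
    by (intro sum.cong refl) auto
  also have "\<dots> = p + T p"
    by (simp add: sum.distrib del: sum.atMost_Suc)
  finally show "coef (opser (1 + fps_X) T p) w = coef (p + T p) w"
    by (simp add: agree_def)
qed

lemma opser_power: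
  assumes "raising T"
  shows "opser (L ^ n) T p = (opser L T ^^ n) p"
  by (induction n arbitrary: p) (simp_all add: opser_1 opser_mult assms)

text \<open>\<open>L $ 0 = 0\<close> makes \<open>opser L T\<close> raising again and lets
  \<open>L ^ n\<close> start in degree \<open>n\<close>, so both series may be truncated at
  \<open>N\<close>.\<close>

lemma opser_compose:
  assumes T: "raising T" and L: "L $ 0 = 0"
  shows "opser (F oo L) T p = opser F (opser L T) p"
proof (rule opser_eqI[OF T])
  fix N
  have "agree (Suc N) (opser F (opser L T) p) (\<Sum>n\<le>N. (F $ n) *\<^sub>R opser (L ^ n) T p)"
    unfolding opser_power[OF T] by (rule opser_agree_sum[OF raising_opser[OF T L]])
  also have "agree (Suc N) \<dots> (\<Sum>n\<le>N. (F $ n) *\<^sub>R (\<Sum>k\<le>N. ((L ^ n) $ k) *\<^sub>R (T ^^ k) p))"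
    by (intro agree_sum agree_scaleR opser_agree_sum[OF T])
  also have "\<dots> = (\<Sum>k\<le>N. \<Sum>n\<le>N. (F $ n * (L ^ n) $ k) *\<^sub>R (T ^^ k) p)"
    by (subst sum.swap) (simp add: scaleR_sum_right)
  also have "\<dots> = (\<Sum>k\<le>N. ((F oo L) $ k) *\<^sub>R (T ^^ k) p)"
  proof (intro sum.cong refl)
    fix k assume k: "k \<in> {..N}"
    have "(F oo L) $ k = (\<Sum>n\<le>N. F $ n * (L ^ n) $ k)"
      unfolding fps_compose_nth using k startsby_zero_power_prefix[OF L]
      by (intro sum.mono_neutral_left) auto
    then show "(\<Sum>n\<le>N. (F $ n * (L ^ n) $ k) *\<^sub>R (T ^^ k) p) = ((F oo L) $ k) *\<^sub>R (T ^^ k) p"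
      by (simp add: scaleR_left.sum)
  qed
  finally show "agree (Suc N) (opser F (opser L T) p) (\<Sum>k\<le>N. ((F oo L) $ k) *\<^sub>R (T ^^ k) p)" .
qed

lemma raising_mult_left: "agree 1 P 0 \<Longrightarrow> raising ((*) P)"
  unfolding raising_def using agree_mult_0[of 1 P]
  by (auto simp: linear_iff distrib_left)

lemma funpow_mult_left: "((*) P ^^ n) q = P ^ n * q" for P :: ncs
  by (induction n) (simp_all add: mult.assoc)

lemma opser_mult_left:
  assumes "agree 1 P 0"
  shows "opser F ((*) P) q = opser F ((*) P) 1 * q"
proof (rule opser_eqI[OF raising_mult_left[OF assms]])
  fix N
  have "agree (Suc N) (opser F ((*) P) 1 * q) ((\<Sum>n\<le>N. (F $ n) *\<^sub>R ((*) P ^^ n) 1) * q)"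
    by (intro agree_mult opser_agree_sum raising_mult_left assms agree_refl)
  also have "(\<Sum>n\<le>N. (F $ n) *\<^sub>R ((*) P ^^ n) 1) * q = (\<Sum>n\<le>N. (F $ n) *\<^sub>R ((*) P ^^ n) q)"
    by (simp add: funpow_mult_left sum_distrib_right)
  finally show "agree (Suc N) (opser F ((*) P) 1 * q) (\<Sum>n\<le>N. (F $ n) *\<^sub>R ((*) P ^^ n) q)" .
qed

section \<open>The differential equation of the Campbell--Baker--Hausdorff series\<close>

lemma binomial_sum_Suc:
  fixes f :: "nat \<Rightarrow> nat \<Rightarrow> 'a::real_vector"
  shows "(\<Sum>k\<le>Suc n. real (Suc n choose k) *\<^sub>R f k (Suc n - k)) =
    (\<Sum>k\<le>n. real (n choose k) *\<^sub>R f (Suc k) (n - k)) + (\<Sum>k\<le>n. real (n choose k) *\<^sub>R f k (Suc (n - k)))"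
proof -
  have "(\<Sum>k\<le>n. real (n choose k) *\<^sub>R f k (Suc (n - k))) =
      (\<Sum>k\<le>Suc n. real (n choose k) *\<^sub>R f k (Suc n - k))"
    by (simp add: Suc_diff_le)
  also have "\<dots> = f 0 (Suc n) + (\<Sum>k\<le>n. real (n choose Suc k) *\<^sub>R f (Suc k) (n - k))"
    by (subst sum.atMost_Suc_shift) simp
  finally show ?thesis
    by (subst sum.atMost_Suc_shift) (simp add: scaleR_left_distrib sum.distrib)
qed

text \<open>The assumption makes \<open>B (Suc k)\<close> the commutator of \<open>L\<close> with
  \<open>B k\<close>; moving powers of \<open>L\<close> past \<open>B 0\<close> then follows the
  Leibniz rule, with Pascal's rule as induction step.\<close>

lemma funpow_commute_binomial:
  assumes "linear L"
    and comm: "\<And>k q. L (B k q) = B (Suc k) q + B k (L q)"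
  shows "(L ^^ n) (B 0 q) = (\<Sum>k\<le>n. real (n choose k) *\<^sub>R B k ((L ^^ (n - k)) q))"
proof (induction n)
  case (Suc n)
  have "(L ^^ Suc n) (B 0 q) = (\<Sum>k\<le>n. real (n choose k) *\<^sub>R L (B k ((L ^^ (n - k)) q)))"
    by (simp add: Suc.IH linear_sum[OF assms(1)] linear_cmul[OF assms(1)])
  also have "\<dots> = (\<Sum>k\<le>n. real (n choose k) *\<^sub>R B (Suc k) ((L ^^ (n - k)) q)) +
      (\<Sum>k\<le>n. real (n choose k) *\<^sub>R B k ((L ^^ Suc (n - k)) q))"
    by (simp add: comm scaleR_right_distrib sum.distrib)
  also have "\<dots> = (\<Sum>k\<le>Suc n. real (Suc n choose k) *\<^sub>R B k ((L ^^ (Suc n - k)) q))"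
    by (rule binomial_sum_Suc[of n "\<lambda>k l. B k ((L ^^ l) q)", symmetric])
  finally show ?case .
qed simp

text \<open>This is \<open>exp L \<circ> B = exp (ad L) B \<circ> exp L\<close>, where \<open>B k\<close> is the \<open>k\<close>-fold commutator of \<open>L\<close> with \<open>B 0\<close>.\<close>

lemma opser_exp_commute:
  fixes B :: "nat \<Rightarrow> ncs \<Rightarrow> ncs"
  assumes L: "raising L"
    and comm: "\<And>k q. L (B k q) = B (Suc k) q + B k (L q)"
    and lin: "\<And>k. linear (B k)"
    and deg: "\<And>k n q. agree n q 0 \<Longrightarrow> agree (n + k) (B k q) 0"
  shows "agree (Suc N) (opser (fps_exp 1) L (B 0 q)) (\<Sum>k\<le>N. (1 / fact k) *\<^sub>R B k (opser (fps_exp 1) L q))"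
proof -
  have B_agree: "agree n (B k p) (B k p')" if "agree n p p'" for n k p p'
  proof -
    have "agree (n + k) (B k (p - p')) 0"
      using that by (intro deg) (simp add: agree_diff_0)
    then show ?thesis
      unfolding linear_diff[OF lin] agree_diff_0 by (rule agree_mono) simp
  qed
  have "agree (Suc N) (\<Sum>k\<le>N. (1 / fact k) *\<^sub>R B k (opser (fps_exp 1) L q))
      (\<Sum>k\<le>N. (1 / fact k) *\<^sub>R B k (\<Sum>l\<le>N. (fps_exp 1 $ l) *\<^sub>R (L ^^ l) q))"
    by (intro agree_sum agree_scaleR B_agree opser_agree_sum L)
  also have "\<dots> = (\<Sum>k\<le>N. \<Sum>l\<le>N. (1 / (fact k * fact l)) *\<^sub>R B k ((L ^^ l) q))"
    by (simp add: linear_sum[OF lin] linear_cmul[OF lin] scaleR_sum_right)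
  also have "agree (Suc N) \<dots> (\<Sum>n\<le>N. \<Sum>k\<le>n. (1 / (fact k * fact (n - k))) *\<^sub>R B k ((L ^^ (n - k)) q))"
    unfolding agree_def
  proof (intro allI impI)
    fix w :: "gen list" assume w: "length w < Suc N"
    have "coef (B k ((L ^^ l) q)) w = 0" if "k + l > N" for k l
      using deg[OF raising_pow(2)[OF L, of 0 q l], of k] that w by (simp add: agree_def)
    then have "(\<Sum>k\<le>N. \<Sum>l\<le>N. 1 / (fact k * fact l) * coef (B k ((L ^^ l) q)) w) =
        (\<Sum>n\<le>N. \<Sum>k\<le>n. 1 / (fact k * fact (n - k)) * coef (B k ((L ^^ (n - k)) q)) w)"
      by (intro sum_square_eq_triangle) auto
    then show "coef (\<Sum>k\<le>N. \<Sum>l\<le>N. (1 / (fact k * fact l)) *\<^sub>R B k ((L ^^ l) q)) w =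
        coef (\<Sum>n\<le>N. \<Sum>k\<le>n. (1 / (fact k * fact (n - k))) *\<^sub>R B k ((L ^^ (n - k)) q)) w"
      by simp
  qed
  also have "\<dots> = (\<Sum>n\<le>N. (fps_exp 1 $ n) *\<^sub>R (L ^^ n) (B 0 q))"
  proof (intro sum.cong refl)
    fix n assume "n \<in> {..N}"
    have "linear L" using L by (simp add: raising_def)
    have "1 / (fact k * fact (n - k)) = (1 / fact n) * real (n choose k)" if "k \<le> n" for k
      using that by (simp add: binomial_fact)
    then show "(\<Sum>k\<le>n. (1 / (fact k * fact (n - k))) *\<^sub>R B k ((L ^^ (n - k)) q)) =
        (fps_exp 1 $ n) *\<^sub>R (L ^^ n) (B 0 q)"
      by (simp add: funpow_commute_binomial[of L B, OF \<open>linear L\<close> comm] scaleR_sum_right)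
  qed
  also have "agree (Suc N) \<dots> (opser (fps_exp 1) L (B 0 q))"
    by (rule agree_sym[OF opser_agree_sum[OF L]])
  finally show ?thesis by (rule agree_sym)
qed

section \<open>The series exp x exp y and its logarithm\<close>

abbreviation nX :: "gen list \<Rightarrow> nat" where "nX w \<equiv> count_list w GX"
abbreviation nY :: "gen list \<Rightarrow> nat" where "nY w \<equiv> count_list w GY"

lemma nX_plus_nY: "nX w + nY w = length w"
proof (induction w)
  case (Cons g w)
  then show ?case by (cases g) auto
qed simp

lemma count_list_take_drop: "count_list (take k w) g + count_list (drop k w) g = count_list w g"
  by (metis append_take_drop_id count_list_append)

definition xy_word :: "nat \<Rightarrow> nat \<Rightarrow> gen list" where
  "xy_word i j = replicate i GX @ replicate j GY"

lemma count_xy_word [simp]: "nX (xy_word i j) = i" "nY (xy_word i j) = j"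
proof -
  have "count_list (replicate n g) h = (if g = h then n else 0)" for n and g h :: gen
    by (induction n) auto
  then show "nX (xy_word i j) = i" "nY (xy_word i j) = j"
    by (simp_all add: xy_word_def)
qed

text \<open>This is \<open>exp x * exp y\<close>: its only words are blocks
  \<open>x^i y^j\<close>.\<close>

definition exp_xy :: ncs where
  "exp_xy = Ncs (\<lambda>w. if w = xy_word (nX w) (nY w) then 1 / (fact (nX w) * fact (nY w)) else 0)"

definition bch :: ncs where
  "bch = opser (fps_ln 1) ((*) (exp_xy - 1)) 1"

definition ad_bch :: "ncs \<Rightarrow> ncs" where
  "ad_bch q = bch * q - q * bch"

definition nc_y :: ncs where "nc_y = Ncs PY"

definition ydeg :: "ncs \<Rightarrow> ncs" where
  "ydeg p = Ncs (\<lambda>w. real (nY w) * coef p w)"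

lemma coef_ydeg [simp]: "coef (ydeg p) w = real (nY w) * coef p w"
  by (simp add: ydeg_def)

lemma ydeg_mult: "ydeg (p * q) = ydeg p * q + p * ydeg q"
proof (rule ncs_eqI)
  fix w
  have nY: "real (nY w) = real (nY (take k w)) + real (nY (drop k w))" for k
    using count_list_take_drop[of k w GY] by linarith
  have "real (nY w) * (coef p (take k w) * coef q (drop k w)) =
      real (nY (take k w)) * coef p (take k w) * coef q (drop k w) +
      coef p (take k w) * (real (nY (drop k w)) * coef q (drop k w))" for k
    unfolding nY[of k] by (simp add: algebra_simps)
  then show "coef (ydeg (p * q)) w = coef (ydeg p * q + p * ydeg q) w"
    by (simp only: coef_ydeg coef_mult coef_add sum_distrib_left sum.distrib)
qed

lemma linear_ydeg: "linear ydeg"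
  by (intro linearI ncs_eqI) (simp_all add: algebra_simps)

lemma ydeg_agree_0: "agree n p 0 \<Longrightarrow> agree n (ydeg p) 0"
  by (simp add: agree_def)

text \<open>Compare last letters. A block ending in \<open>y\<close> loses that letter, and
  \<open>j / fact j = 1 / fact (j - 1)\<close>; a block ending in \<open>x\<close> has no
  \<open>y\<close>, and both sides vanish.\<close>

lemma ydeg_exp_xy: "ydeg exp_xy = exp_xy * nc_y"
proof (rule ncs_eqI)
  fix w :: "gen list"
  show "coef (ydeg exp_xy) w = coef (exp_xy * nc_y) w"
  proof (cases w rule: rev_cases)
    case Nil
    then show ?thesis by (simp add: coef_mult nc_y_def PY_def)
  next
    case (snoc v g)
    have "coef (exp_xy * nc_y) w = (\<Sum>k\<le>length w. if k = length v \<and> g = GY then coef exp_xy v else 0)"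
      unfolding coef_mult
    proof (intro sum.cong refl)
      fix k assume "k \<in> {..length w}"
      then have k: "k \<le> Suc (length v)" by (simp add: snoc)
      have "drop k w = [GY] \<longleftrightarrow> k = length v \<and> g = GY"
      proof
        assume *: "drop k w = [GY]"
        then have "length (drop k w) = 1" by simp
        then have "k = length v" using k by (simp add: snoc)
        with * show "k = length v \<and> g = GY" by (simp add: snoc)
      qed (simp add: snoc)
      then show "coef exp_xy (take k w) * coef nc_y (drop k w) = (if k = length v \<and> g = GY then coef exp_xy v else 0)"
        by (auto simp: nc_y_def PY_def snoc)
    qed
    also have "\<dots> = (if g = GY then coef exp_xy v else 0)"
      by (cases "g = GY") (simp_all add: snoc)
    finally have rhs: "coef (exp_xy * nc_y) w = (if g = GY then coef exp_xy v else 0)" .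
    show ?thesis
    proof (cases g)
      case GX
      have "nY w = 0" if "w = xy_word (nX w) (nY w)"
      proof (rule ccontr)
        assume "nY w \<noteq> 0"
        then have "last (xy_word (nX w) (nY w)) = GY" by (simp add: xy_word_def)
        moreover have "last w = GX" by (simp add: snoc GX)
        ultimately show False using that by simp
      qed
      then show ?thesis using GX unfolding rhs by (auto simp: exp_xy_def)
    next
      case GY
      have "xy_word (nX w) (nY w) = xy_word (nX v) (nY v) @ [GY]"
        by (simp add: snoc GY xy_word_def replicate_append_same)
      then have "w = xy_word (nX w) (nY w) \<longleftrightarrow> v = xy_word (nX v) (nY v)"
        by (simp add: snoc GY)
      moreover have "nX w = nX v" "nY w = Suc (nY v)" by (simp_all add: snoc GY)
      ultimately show ?thesis
        unfolding rhs by (simp add: GY exp_xy_def)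
    qed
  qed
qed

lemma exp_xy_minus_1: "agree 1 (exp_xy - 1) 0"
  by (simp add: agree_def exp_xy_def coef_1 xy_word_def)

lemma bch_agree_0: "agree 1 bch 0"
  by (simp add: agree_def bch_def opser_def)

text \<open>In left multiplication by \<open>exp_xy - 1\<close>, the exponential composed with the
  logarithm series leaves \<open>1 + X\<close>.\<close>

lemma exp_mult_bch: "opser (fps_exp 1) ((*) bch) q = exp_xy * q"
proof -
  let ?T = "(*) (exp_xy - 1)"
  have T: "raising ?T" by (rule raising_mult_left[OF exp_xy_minus_1])
  have "opser (fps_ln 1) ?T p = bch * p" for p
    unfolding bch_def by (rule opser_mult_left[OF exp_xy_minus_1])
  then have "opser (fps_ln 1) ?T = (*) bch" by blast
  then have "opser (fps_exp 1) ((*) bch) q = opser (fps_exp 1 oo fps_ln 1) ?T q"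
    by (simp add: opser_compose[OF T])
  also have "fps_exp 1 oo fps_ln 1 = 1 + (fps_X :: real fps)"
  proof -
    have "(fps_exp 1 - 1) oo fps_ln 1 = (fps_X :: real fps)"
      using fps_inv_fps_exp_compose(2)[of "1::real"] by (simp add: fps_ln_fps_exp_inv)
    then show ?thesis by (simp add: fps_compose_sub_distrib algebra_simps)
  qed
  also have "opser (1 + fps_X) ?T q = q + (exp_xy - 1) * q"
    by (rule opser_1_plus_X[OF T])
  finally show ?thesis
    by (simp add: left_diff_distrib)
qed

text \<open>The geometric series in \<open>exp_xy - 1\<close>; it serves to cancel
  \<open>exp_xy\<close> on the right.\<close>

lemma exp_xy_right_inverse: "\<exists>V. exp_xy * V = 1"
proof -
  let ?T = "(*) (exp_xy - 1)"
  have T: "raising ?T" by (rule raising_mult_left[OF exp_xy_minus_1])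
  have "opser ((1 + fps_X) * inverse (1 + fps_X)) ?T 1 = 1"
    by (subst inverse_mult_eq_1') (simp_all add: opser_1 T)
  then have "V + (exp_xy - 1) * V = 1" if "V = opser (inverse (1 + fps_X)) ?T 1" for V
    by (simp only: opser_mult[OF T] opser_1_plus_X[OF T] that)
  then show ?thesis by (auto simp: left_diff_distrib)
qed

lemma raising_ad_bch: "raising ad_bch"
  unfolding raising_def
proof (intro conjI allI impI)
  show "linear ad_bch"
    by (intro linearI) (simp_all add: ad_bch_def algebra_simps)
  fix n p assume p: "agree n p 0"
  have "agree (Suc n) (bch * p) 0" "agree (Suc n) (p * bch) 0"
    using agree_mult_0[OF bch_agree_0 p] agree_mult_0[OF p bch_agree_0] by simp_all
  then show "agree (Suc n) (ad_bch p) 0"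
    using agree_diff by (fastforce simp: ad_bch_def)
qed

lemma agree_mult_right: "agree n p q \<Longrightarrow> agree n (p * r) (q * r)"
  by (rule agree_mult) simp_all

text \<open>The conjugation formula \<open>exp Z * y * exp (- Z) = exp (ad Z) y\<close>, written
  without inverse. It is \<open>opser_exp_commute\<close> for left multiplications by
  \<open>bch\<close> and \<open>nc_y\<close>, evaluated at 1.\<close>

lemma exp_ad_bch_y: "opser (fps_exp 1) ad_bch nc_y * exp_xy = exp_xy * nc_y"
proof (rule agree_imp_eq)
  fix N
  define B where "B k q = (ad_bch ^^ k) nc_y * q" for k q
  have ad: "agree k ((ad_bch ^^ k) p) 0" for k p
    using raising_pow(2)[OF raising_ad_bch, of 0 p k] by simp
  have "agree (Suc N) (opser (fps_exp 1) ((*) bch) (B 0 1))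
      (\<Sum>k\<le>N. (1 / fact k) *\<^sub>R B k (opser (fps_exp 1) ((*) bch) 1))"
  proof (rule opser_exp_commute)
    show "agree (n + k) (B k q) 0" if "agree n q 0" for k n q
      using agree_mult_0[OF ad that] by (simp add: B_def add.commute)
    show "linear (B k)" for k
      by (intro linearI) (simp_all add: B_def algebra_simps)
    show "bch * B k q = B (Suc k) q + B k (bch * q)" for k q
      by (simp add: B_def ad_bch_def algebra_simps)
  qed (rule raising_mult_left[OF bch_agree_0])
  also have "\<dots> = (\<Sum>k\<le>N. (fps_exp 1 $ k) *\<^sub>R (ad_bch ^^ k) nc_y) * exp_xy"
    by (simp add: B_def exp_mult_bch sum_distrib_right)
  also have "agree (Suc N) \<dots> (opser (fps_exp 1) ad_bch nc_y * exp_xy)"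
    by (intro agree_mult_right agree_sym[OF opser_agree_sum] raising_ad_bch)
  finally show "agree (Suc N) (opser (fps_exp 1) ad_bch nc_y * exp_xy) (exp_xy * nc_y)"
    by (subst (asm) exp_mult_bch) (rule agree_sym, simp add: B_def)
qed

text \<open>The formula for the derivative of an exponential. It results from moving
  \<open>exp Z\<close> past the operator \<open>ydeg\<close> and applying both sides to 1, which
  \<open>ydeg\<close> kills.\<close>

lemma expm1_quot_ad_bch_ydeg: "opser fps_expm1_quot ad_bch (ydeg bch) * exp_xy = ydeg exp_xy"
proof (rule agree_imp_eq)
  fix N
  \<comment> \<open>The commutator of left multiplication by \<open>bch\<close> with
    \<open>ydeg\<close> is left multiplication by \<open>- ydeg bch\<close>; further commutators
    only apply \<open>ad_bch\<close>.\<close>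
  define B where "B k q = (case k of 0 \<Rightarrow> ydeg q | Suc k \<Rightarrow> - ((ad_bch ^^ k) (ydeg bch) * q))" for k q
  have ad: "agree (Suc k) ((ad_bch ^^ k) (ydeg bch)) 0" for k
    using raising_pow(2)[OF raising_ad_bch ydeg_agree_0[OF bch_agree_0], of k] by simp
  have "agree (Suc (Suc N)) (opser (fps_exp 1) ((*) bch) (B 0 1))
      (\<Sum>k\<le>Suc N. (1 / fact k) *\<^sub>R B k (opser (fps_exp 1) ((*) bch) 1))"
  proof (rule opser_exp_commute)
    show "agree (n + k) (B k q) 0" if "agree n q 0" for k n q
    proof (cases k)
      case (Suc m)
      then show ?thesis
        using agree_mult_0[OF ad[of m] that] by (simp add: B_def agree_def)
    qed (use that in \<open>simp add: B_def ydeg_agree_0\<close>)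
    show "linear (B k)" for k
      by (cases k; intro linearI) (simp_all add: B_def linear_add[OF linear_ydeg] linear_cmul[OF linear_ydeg] algebra_simps)
    show "bch * B k q = B (Suc k) q + B k (bch * q)" for k q
      by (cases k) (simp_all add: B_def ad_bch_def ydeg_mult algebra_simps)
  qed (rule raising_mult_left[OF bch_agree_0])
  also have "opser (fps_exp 1) ((*) bch) (B 0 1) = 0"
    using ydeg_mult[of 1 1] by (simp add: B_def exp_mult_bch)
  \<comment> \<open>Shifting the index by one turns \<open>1 / fact (Suc k)\<close> into the
    coefficient of \<open>fps_expm1_quot\<close>.\<close>
  also have "(\<Sum>k\<le>Suc N. (1 / fact k) *\<^sub>R B k (opser (fps_exp 1) ((*) bch) 1)) =
      ydeg exp_xy - (\<Sum>k\<le>N. (fps_expm1_quot $ k) *\<^sub>R (ad_bch ^^ k) (ydeg bch)) * exp_xy"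
    by (subst sum.atMost_Suc_shift)
      (simp add: B_def exp_mult_bch sum_distrib_right fps_expm1_quot_def sum_negf del: fact_Suc)
  finally have "agree (Suc N) 0 (ydeg exp_xy - (\<Sum>k\<le>N. (fps_expm1_quot $ k) *\<^sub>R (ad_bch ^^ k) (ydeg bch)) * exp_xy)"
    by (rule agree_mono) simp
  then have "agree (Suc N) (ydeg exp_xy) ((\<Sum>k\<le>N. (fps_expm1_quot $ k) *\<^sub>R (ad_bch ^^ k) (ydeg bch)) * exp_xy)"
    by (metis agree_sym agree_diff_0)
  also have "agree (Suc N) \<dots> (opser fps_expm1_quot ad_bch (ydeg bch) * exp_xy)"
    by (intro agree_mult_right agree_sym[OF opser_agree_sum] raising_ad_bch)
  finally show "agree (Suc N) (opser fps_expm1_quot ad_bch (ydeg bch) * exp_xy) (ydeg exp_xy)"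
    by (rule agree_sym)
qed

text \<open>Two expressions for \<open>ydeg exp_xy\<close> are compared:
  \<open>(exp (ad Z) - 1) / ad Z\<close> applied to \<open>ydeg bch\<close> equals
  \<open>exp (ad Z) y\<close>, and dividing the series yields \<open>kappa\<close>.\<close>

lemma ydeg_bch: "ydeg bch = opser kappa ad_bch nc_y"
proof -
  obtain V where V: "exp_xy * V = 1" using exp_xy_right_inverse by blast
  have "opser fps_expm1_quot ad_bch (ydeg bch) * exp_xy * V = opser (fps_exp 1) ad_bch nc_y * exp_xy * V"
    by (simp add: expm1_quot_ad_bch_ydeg exp_ad_bch_y ydeg_exp_xy)
  then have "opser fps_expm1_quot ad_bch (ydeg bch) = opser (fps_exp 1) ad_bch nc_y"
    by (simp add: mult.assoc V)
  then have "opser (inverse fps_expm1_quot * fps_expm1_quot) ad_bch (ydeg bch) =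
      opser (inverse fps_expm1_quot * fps_exp 1) ad_bch nc_y"
    by (simp add: opser_mult[OF raising_ad_bch])
  then show ?thesis
    by (simp add: inverse_expm1_quot kappa_def opser_1[OF raising_ad_bch])
qed

section \<open>Bihomogeneous components\<close>

definition bicomp :: "nat \<Rightarrow> nat \<Rightarrow> ncs \<Rightarrow> ncs" where
  "bicomp i j p = Ncs (\<lambda>w. if nX w = i \<and> nY w = j then coef p w else 0)"

lemma coef_bicomp [simp]: "coef (bicomp i j p) w = (if nX w = i \<and> nY w = j then coef p w else 0)"
  by (simp add: bicomp_def)

lemma linear_bicomp: "linear (bicomp i j)"
  by (intro linearI ncs_eqI) simp_all

text \<open>At a given cut, the letter counts of the prefix select the only pair
  \<open>(i', j')\<close> that contributes.\<close>

lemma bicomp_mult: "bicomp i j (p * q) = (\<Sum>i'\<le>i. \<Sum>j'\<le>j. bicomp i' j' p * bicomp (i - i') (j - j') q)"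
proof (rule ncs_eqI)
  fix w
  define t where "t k i' j' = coef (bicomp i' j' p) (take k w) * coef (bicomp (i - i') (j - j') q) (drop k w)"
    for k i' j'
  have inner: "(\<Sum>i'\<le>i. \<Sum>j'\<le>j. t k i' j') =
      (if nX w = i \<and> nY w = j then coef p (take k w) * coef q (drop k w) else 0)" for k
  proof -
    have "t k i' j' = (if j' = nY (take k w) then if i' = nX (take k w) then t k i' j' else 0 else 0)" for i' j'
      by (simp add: t_def)
    then have "(\<Sum>i'\<le>i. \<Sum>j'\<le>j. t k i' j') = (\<Sum>i'\<le>i. \<Sum>j'\<le>j.
        if j' = nY (take k w) then if i' = nX (take k w) then t k i' j' else 0 else 0)"
      by presburger
    also have "\<dots> = (if nX (take k w) \<le> i \<and> nY (take k w) \<le> j then t k (nX (take k w)) (nY (take k w)) else 0)"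
      by (cases "nY (take k w) \<le> j") simp_all
    also have "\<dots> = (if nX w = i \<and> nY w = j then coef p (take k w) * coef q (drop k w) else 0)"
      using count_list_take_drop[of k w GX] count_list_take_drop[of k w GY] by (auto simp: t_def)
    finally show ?thesis .
  qed
  have "coef (\<Sum>i'\<le>i. \<Sum>j'\<le>j. bicomp i' j' p * bicomp (i - i') (j - j') q) w =
      (\<Sum>i'\<le>i. \<Sum>j'\<le>j. \<Sum>k\<le>length w. t k i' j')"
    by (simp only: coef_sum coef_mult t_def)
  also have "\<dots> = (\<Sum>i'\<le>i. \<Sum>k\<le>length w. \<Sum>j'\<le>j. t k i' j')"
    by (rule sum.cong[OF refl sum.swap])
  also have "\<dots> = (\<Sum>k\<le>length w. \<Sum>i'\<le>i. \<Sum>j'\<le>j. t k i' j')"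
    by (rule sum.swap)
  also have "\<dots> = coef (bicomp i j (p * q)) w"
    unfolding inner by (auto simp: coef_mult intro!: sum.neutral)
  finally show "coef (bicomp i j (p * q)) w =
      coef (\<Sum>i'\<le>i. \<Sum>j'\<le>j. bicomp i' j' p * bicomp (i - i') (j - j') q) w" ..
qed

lemma bicomp_mult': "bicomp i j (p * q) = (\<Sum>i'\<le>i. \<Sum>j'\<le>j. bicomp (i - i') (j - j') p * bicomp i' j' q)"
proof -
  have rev: "(\<Sum>k\<le>n. f k) = (\<Sum>k\<le>n. f (n - k))" for n and f :: "nat \<Rightarrow> ncs"
    by (rule sum.reindex_bij_witness[of _ "\<lambda>k. n - k" "\<lambda>k. n - k"]) auto
  show ?thesis
    unfolding bicomp_mult by (subst rev, subst rev) (simp cong: sum.cong_simp)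
qed

section \<open>Comparison with the explicit formula for the components\<close>

definition xy_decomps :: "nat \<Rightarrow> gen list \<Rightarrow> (nat \<times> nat) list set" where
  "xy_decomps n w = {s. length s = n \<and> (\<forall>p\<in>set s. p \<noteq> (0, 0)) \<and> word_of s = w}"

lemma word_of_simps [simp]: "word_of [] = []" "word_of (p # s) = xy_word (fst p) (snd p) @ word_of s"
  by (simp_all add: word_of_def xy_word_def case_prod_beta)

lemma count_word_of: "nX (word_of s) = sum_list (map fst s)" "nY (word_of s) = sum_list (map snd s)"
  by (induction s) simp_all

lemma length_xy_word [simp]: "length (xy_word i j) = i + j"
  by (simp add: xy_word_def)

lemma finite_seqs: "finite (seqs n i j)"
proof (rule finite_subset)
  show "seqs n i j \<subseteq> {s. set s \<subseteq> {..i} \<times> {..j} \<and> length s = n}"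
  proof
    fix s assume s: "s \<in> seqs n i j"
    have "fst p \<le> i \<and> snd p \<le> j" if "p \<in> set s" for p
      using s that member_le_sum_list[of "fst p" "map fst s"] member_le_sum_list[of "snd p" "map snd s"]
      by (simp add: seqs_def)
    then show "s \<in> {s. set s \<subseteq> {..i} \<times> {..j} \<and> length s = n}"
      using s by (force simp: seqs_def)
  qed
qed (simp add: finite_lists_length_eq)

lemma xy_decomps_eq: "xy_decomps n w = {s \<in> seqs n (nX w) (nY w). word_of s = w}"
  by (auto simp: xy_decomps_def seqs_def count_word_of)

lemma finite_xy_decomps: "finite (xy_decomps n w)"
  unfolding xy_decomps_eq using finite_seqs by simp

definition xy_weight :: "(nat \<times> nat) list \<Rightarrow> real" where
  "xy_weight s = 1 / (\<Prod>p\<leftarrow>s. fact (fst p) * fact (snd p))"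

text \<open>Subtracting 1 forbids empty blocks, so the power enumerates the factorisations of
  \<open>w\<close> into \<open>n\<close> nonempty blocks \<open>x^i y^j\<close>. The induction
  splits off the first block.\<close>

lemma coef_exp_xy_minus_1_power: "coef ((exp_xy - 1) ^ n) w = (\<Sum>s\<in>xy_decomps n w. xy_weight s)"
proof (induction n arbitrary: w)
  case 0
  have "xy_decomps 0 w = (if w = [] then {[]} else {})"
    by (auto simp: xy_decomps_def)
  then show ?case by (simp add: coef_1 xy_weight_def)
next
  case (Suc n)
  let ?P = "\<lambda>k. take k w \<noteq> [] \<and> take k w = xy_word (nX (take k w)) (nY (take k w))"
  let ?v = "\<lambda>k. (nX (take k w), nY (take k w))"
  have P: "coef (exp_xy - 1) (take k w) =
      (if ?P k then 1 / (fact (nX (take k w)) * fact (nY (take k w))) else 0)" for k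
    by (cases "take k w = []") (auto simp: exp_xy_def coef_1 xy_word_def)
  have "coef ((exp_xy - 1) ^ Suc n) w =
      (\<Sum>k\<le>length w. coef (exp_xy - 1) (take k w) * (\<Sum>s\<in>xy_decomps n (drop k w). xy_weight s))"
    by (simp add: coef_mult Suc.IH del: coef_diff)
  also have "\<dots> = (\<Sum>k\<in>{k. k \<le> length w \<and> ?P k}. \<Sum>s\<in>xy_decomps n (drop k w). xy_weight (?v k # s))"
    unfolding P by (rule sum.mono_neutral_cong_right) (auto simp: sum_distrib_left xy_weight_def)
  also have "\<dots> = (\<Sum>(k, s)\<in>(SIGMA k:{k. k \<le> length w \<and> ?P k}. xy_decomps n (drop k w)). xy_weight (?v k # s))"
    by (rule sum.Sigma) (auto simp: finite_xy_decomps)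
  also have "\<dots> = (\<Sum>s\<in>xy_decomps (Suc n) w. xy_weight s)"
  \<comment> \<open>The cut \<open>k\<close> determines the first block through the letter counts of
    the prefix and is recovered as the length of that block.\<close>
  proof (rule sum.reindex_bij_witness[of _ "\<lambda>s. (fst (hd s) + snd (hd s), tl s)" "\<lambda>(k, s). ?v k # s"])
    fix s assume "s \<in> xy_decomps (Suc n) w"
    then obtain p s' where s: "s = p # s'" "length s' = n" "p \<noteq> (0, 0)" "\<forall>p\<in>set s'. p \<noteq> (0, 0)"
      and w: "w = xy_word (fst p) (snd p) @ word_of s'"
      by (cases s) (auto simp: xy_decomps_def)
    have take: "take (fst p + snd p) w = xy_word (fst p) (snd p)" "drop (fst p + snd p) w = word_of s'"
      by (simp_all add: w)
    show "(case (fst (hd s) + snd (hd s), tl s) of (k, s) \<Rightarrow> ?v k # s) = s"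
      using take by (simp add: s)
    have "xy_word (fst p) (snd p) \<noteq> []"
      using s(3) by (cases p) (auto simp: xy_word_def)
    then show "(fst (hd s) + snd (hd s), tl s) \<in> (SIGMA k:{k. k \<le> length w \<and> ?P k}. xy_decomps n (drop k w))"
      using s take by (auto simp: xy_decomps_def w prod_eq_iff)
  next
    fix ks assume "ks \<in> (SIGMA k:{k. k \<le> length w \<and> ?P k}. xy_decomps n (drop k w))"
    then obtain k s where ks: "ks = (k, s)" "k \<le> length w" "?P k" "s \<in> xy_decomps n (drop k w)"
      by auto
    have k: "nX (take k w) + nY (take k w) = k"
      using nX_plus_nY[of "take k w"] ks(2) by simp
    then show "(fst (hd (case ks of (k, s) \<Rightarrow> ?v k # s)) + snd (hd (case ks of (k, s) \<Rightarrow> ?v k # s)),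
        tl (case ks of (k, s) \<Rightarrow> ?v k # s)) = ks"
      by (simp add: ks(1))
    have "k > 0" using ks(3) by (cases k) auto
    then have "?v k \<noteq> (0, 0)" using k by auto
    moreover have "word_of (?v k # s) = w"
      using ks(3,4) by (simp add: xy_decomps_def)
    ultimately show "(case ks of (k, s) \<Rightarrow> ?v k # s) \<in> xy_decomps (Suc n) w"
      using ks(4) by (auto simp: ks(1) xy_decomps_def)
    show "xy_weight (case ks of (k, s) \<Rightarrow> ?v k # s) = (case ks of (k, s) \<Rightarrow> xy_weight (?v k # s))"
      by (simp add: ks(1))
  qed
  finally show ?case .
qed

lemma coef_bch: "coef bch w = (\<Sum>n\<le>length w. (fps_ln 1 $ n) * coef ((exp_xy - 1) ^ n) w)"
  by (simp add: bch_def opser_def funpow_mult_left)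

text \<open>A sequence in \<open>seqs n i j\<close> can spell \<open>w\<close> only if
  \<open>w\<close> has bidegree \<open>(i, j)\<close>. The logarithm series then stops at the word
  length \<open>i + j\<close> and has no term \<open>n = 0\<close>.\<close>

lemma Zpoly_eq_bicomp_bch: "Zpoly i j = coef (bicomp i j bch)"
proof
  fix w
  have inner: "(\<Sum>s\<in>seqs n i j. if word_of s = w then 1 / (\<Prod>p\<leftarrow>s. fact (fst p) * fact (snd p)) else 0) =
      (if nX w = i \<and> nY w = j then coef ((exp_xy - 1) ^ n) w else 0)" for n
  proof (cases "nX w = i \<and> nY w = j")
    case True
    then show ?thesis
      unfolding coef_exp_xy_minus_1_power xy_decomps_eq xy_weight_def
      by (simp add: sum.inter_filter finite_seqs)
  next
    case False
    then have "word_of s \<noteq> w" if "s \<in> seqs n i j" for s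
      using that count_word_of[of s] by (auto simp: seqs_def)
    then show ?thesis using False by (auto intro!: sum.neutral)
  qed
  show "Zpoly i j w = coef (bicomp i j bch) w"
  proof (cases "nX w = i \<and> nY w = j")
    case True
    then have len: "length w = i + j" using nX_plus_nY[of w] by simp
    have "coef bch w = (\<Sum>n=1..i+j. (fps_ln 1 $ n) * coef ((exp_xy - 1) ^ n) w)"
      unfolding coef_bch len by (rule sum.mono_neutral_right) (auto simp: Suc_le_eq)
    also have "\<dots> = (\<Sum>n=1..i+j. ((-1) ^ (n + 1) / real n) * coef ((exp_xy - 1) ^ n) w)"
    proof (intro sum.cong refl)
      fix n assume "n \<in> {1..i+j}"
      then obtain m where "n = Suc m" by (cases n) auto
      then show "(fps_ln 1 $ n) * coef ((exp_xy - 1) ^ n) w =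
          ((-1) ^ (n + 1) / real n) * coef ((exp_xy - 1) ^ n) w"
        by (simp add: fps_ln_nth)
    qed
    finally show ?thesis
      using True by (simp add: Zpoly_def inner del: coef_diff)
  next
    case False
    have "(\<Sum>s\<in>seqs n i j. if word_of s = w then 1 / (\<Prod>p\<leftarrow>s. fact (fst p) * fact (snd p)) else 0) = (0::real)" for n
      unfolding inner using False by auto
    then have "Zpoly i j w = 0"
      by (simp add: Zpoly_def)
    then show ?thesis using False by auto
  qed
qed

section \<open>The recursion in the number of letters y\<close>

lemma nY_eq_0_iff: "nY w = 0 \<longleftrightarrow> w = replicate (nX w) GX"
proof (induction w)
  case (Cons g w)
  then show ?case by (cases g; cases "nX w") auto
qed simp

text \<open>On words in \<open>x\<close> alone the series multiply like power series in one
  variable, where \<open>log (exp z) = z\<close>.\<close>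

lemma bicomp_bch_x: "bicomp i 0 bch = (if i = 1 then Ncs PX else 0)"
proof (rule ncs_eqI)
  fix w
  have pow: "coef ((exp_xy - 1) ^ n) (replicate i GX) = ((fps_exp 1 - 1) ^ n) $ i" for n i
  proof (induction n arbitrary: i)
    case 0
    show ?case by (auto simp: coef_1)
  next
    case (Suc n)
    have "coef (exp_xy - 1) (replicate k GX) = (fps_exp 1 - 1) $ k" for k
      using count_xy_word[of k 0] by (auto simp: exp_xy_def coef_1 xy_word_def)
    then show ?case
      by (simp add: coef_mult Suc.IH fps_mult_nth atMost_atLeast0 min_def del: coef_diff fps_sub_nth)
  qed
  have "coef bch (replicate i GX) = (fps_ln 1 oo (fps_exp 1 - 1)) $ i"
    unfolding coef_bch pow by (simp add: fps_compose_nth atMost_atLeast0)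
  also have "\<dots> = fps_X $ i"
    using fps_inv_fps_exp_compose(1)[of "1::real"] by (simp add: fps_ln_fps_exp_inv)
  finally have "coef bch (replicate i GX) = fps_X $ i" .
  then show "coef (bicomp i 0 bch) w = coef (if i = 1 then Ncs PX else 0) w"
    using nY_eq_0_iff[of w] by (auto simp: PX_def)
qed

text \<open>The second index is shifted since every word of \<open>(ad_bch ^^ n) nc_y\<close> contains a letter \<open>y\<close>.\<close>

definition bch_iter :: "nat \<Rightarrow> nat \<Rightarrow> nat \<Rightarrow> ncs" where
  "bch_iter n i j = bicomp i (Suc j) ((ad_bch ^^ n) nc_y)"

lemma bicomp_ad_bch_pow_0: "bicomp i 0 ((ad_bch ^^ n) nc_y) = 0"
proof (induction n arbitrary: i)
  case 0
  show ?case by (rule ncs_eqI) (auto simp: nc_y_def PY_def)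
next
  case (Suc n)
  then show ?case by (simp add: ad_bch_def linear_diff[OF linear_bicomp] bicomp_mult)
qed

lemma bch_iter_0: "bch_iter 0 i j = (if i = 0 \<and> j = 0 then nc_y else 0)"
  by (rule ncs_eqI) (auto simp: bch_iter_def nc_y_def PY_def)

text \<open>The iterates have no part of degree 0 in \<open>y\<close>, so the factor
  \<open>bch\<close> enters with at most \<open>j\<close> letters \<open>y\<close>. This makes
  \<open>bicomp_bch_Suc\<close> a genuine recursion.\<close>

lemma bch_iter_Suc:
  "bch_iter (Suc n) i j = (\<Sum>i'\<le>i. \<Sum>j'\<le>j. bicomp i' j' bch * bch_iter n (i - i') (j - j') -
      bch_iter n (i - i') (j - j') * bicomp i' j' bch)"
proof -
  let ?A = "(ad_bch ^^ n) nc_y"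
  have "bicomp i (Suc j) (bch * ?A) = (\<Sum>i'\<le>i. \<Sum>j'\<le>j. bicomp i' j' bch * bch_iter n (i - i') (j - j'))"
    unfolding bicomp_mult by (simp add: bicomp_ad_bch_pow_0 bch_iter_def Suc_diff_le cong: sum.cong_simp)
  moreover have "bicomp i (Suc j) (?A * bch) = (\<Sum>i'\<le>i. \<Sum>j'\<le>j. bch_iter n (i - i') (j - j') * bicomp i' j' bch)"
    unfolding bicomp_mult' by (simp add: bicomp_ad_bch_pow_0 bch_iter_def Suc_diff_le cong: sum.cong_simp)
  ultimately show ?thesis
    by (simp add: bch_iter_def[of "Suc n"] ad_bch_def linear_diff[OF linear_bicomp] sum_subtractf)
qed

lemma bicomp_bch_Suc:
  "real (Suc j) *\<^sub>R bicomp i (Suc j) bch = (\<Sum>n\<le>i + Suc j. (kappa $ n) *\<^sub>R bch_iter n i j)"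
proof (rule ncs_eqI)
  fix w
  have "coef (ydeg bch) w = (\<Sum>n\<le>length w. (kappa $ n) * coef ((ad_bch ^^ n) nc_y) w)"
    by (simp add: ydeg_bch opser_def)
  then show "coef (real (Suc j) *\<^sub>R bicomp i (Suc j) bch) w =
      coef (\<Sum>n\<le>i + Suc j. (kappa $ n) *\<^sub>R bch_iter n i j) w"
    using nX_plus_nY[of w] by (auto simp: bch_iter_def simp del: sum.atMost_Suc)
qed

section \<open>Majorants\<close>

text \<open>Coefficients of the \<open>n\<close>-th power of the double power series with
  coefficients \<open>z\<close>.\<close>

primrec conv_pow :: "(nat \<Rightarrow> nat \<Rightarrow> real) \<Rightarrow> nat \<Rightarrow> nat \<Rightarrow> nat \<Rightarrow> real" where
  "conv_pow z 0 i j = (if i = 0 \<and> j = 0 then 1 else 0)"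
| "conv_pow z (Suc n) i j = (\<Sum>i'\<le>i. \<Sum>j'\<le>j. z i' j' * conv_pow z n (i - i') (j - j'))"

lemma conv_pow_nonneg: "(\<And>i j. z i j \<ge> 0) \<Longrightarrow> conv_pow z n i j \<ge> 0"
  by (induction n arbitrary: i j) (auto intro!: sum_nonneg)

lemma sum_triangle_le_square:
  fixes g :: "nat \<Rightarrow> nat \<Rightarrow> real"
  assumes "\<And>i j. g i j \<ge> 0"
  shows "(\<Sum>k\<le>N. \<Sum>i\<le>k. g i (k - i)) \<le> (\<Sum>i\<le>N. \<Sum>j\<le>N. g i j)"
proof -
  have "(\<Sum>k\<le>N. \<Sum>i\<le>k. g i (k - i)) = (\<Sum>(i, j)\<in>{(i, j). i + j \<le> N}. g i j)"
    by (rule sum.triangle_reindex_eq[symmetric])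
  also have "\<dots> \<le> (\<Sum>(i, j)\<in>{..N} \<times> {..N}. g i j)"
    using assms by (intro sum_mono2) auto
  finally show ?thesis by (simp add: sum.cartesian_product)
qed

text \<open>With nonnegative terms, truncating in both indices only drops products from the power of
  the truncated sum.\<close>

lemma conv_pow_sum_le:
  fixes z :: "nat \<Rightarrow> nat \<Rightarrow> real" and t :: real
  assumes z: "\<And>i j. z i j \<ge> 0" and t: "t \<ge> 0"
  shows "(\<Sum>i\<le>N. \<Sum>j\<le>N. conv_pow z n i j * t ^ j) \<le> (\<Sum>i\<le>N. \<Sum>j\<le>N. z i j * t ^ j) ^ n"
proof (induction n)
  case 0
  have "(\<Sum>i\<le>N. \<Sum>j\<le>N. conv_pow z 0 i j * t ^ j) = (\<Sum>i\<le>N. \<Sum>j\<le>N. if j = 0 then if i = 0 then 1 else 0 else 0)"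
    by (intro sum.cong refl) auto
  then show ?case by simp
next
  case (Suc n)
  define F where "F i' k j' l = (z i' j' * t ^ j') * (conv_pow z n k l * t ^ l)" for i' k j' l
  have F: "F i' k j' l \<ge> 0" for i' k j' l
    using z t conv_pow_nonneg[OF z] by (simp add: F_def)
  have "(\<Sum>i\<le>N. \<Sum>j\<le>N. conv_pow z (Suc n) i j * t ^ j) =
      (\<Sum>i\<le>N. \<Sum>j\<le>N. \<Sum>i'\<le>i. \<Sum>j'\<le>j. F i' (i - i') j' (j - j'))"
  proof (intro sum.cong refl)
    fix i j
    have "z i' j' * conv_pow z n (i - i') (j - j') * t ^ j = F i' (i - i') j' (j - j')" if "j' \<in> {..j}" for i' j'
    proof -
      have "t ^ j = t ^ j' * t ^ (j - j')"
        using that by (simp add: power_add[symmetric])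
      then show ?thesis by (simp add: F_def)
    qed
    then show "conv_pow z (Suc n) i j * t ^ j = (\<Sum>i'\<le>i. \<Sum>j'\<le>j. F i' (i - i') j' (j - j'))"
      unfolding conv_pow.simps sum_distrib_right by (intro sum.cong refl)
  qed
  also have "\<dots> = (\<Sum>i\<le>N. \<Sum>i'\<le>i. \<Sum>j\<le>N. \<Sum>j'\<le>j. F i' (i - i') j' (j - j'))"
    by (rule sum.cong[OF refl sum.swap])
  also have "\<dots> \<le> (\<Sum>i'\<le>N. \<Sum>k\<le>N. \<Sum>j\<le>N. \<Sum>j'\<le>j. F i' k j' (j - j'))"
    by (rule sum_triangle_le_square) (intro sum_nonneg F)
  also have "\<dots> \<le> (\<Sum>i'\<le>N. \<Sum>k\<le>N. \<Sum>j'\<le>N. \<Sum>l\<le>N. F i' k j' l)"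
    by (intro sum_mono sum_triangle_le_square F)
  also have "\<dots> = (\<Sum>i'\<le>N. \<Sum>j'\<le>N. z i' j' * t ^ j') * (\<Sum>k\<le>N. \<Sum>l\<le>N. conv_pow z n k l * t ^ l)"
    unfolding F_def by (simp only: sum_product[symmetric])
  also have "\<dots> \<le> (\<Sum>i'\<le>N. \<Sum>j'\<le>N. z i' j' * t ^ j') * (\<Sum>i\<le>N. \<Sum>j\<le>N. z i j * t ^ j) ^ n"
    by (intro mult_left_mono Suc.IH sum_nonneg mult_nonneg_nonneg z) (use t in auto)
  finally show ?case by simp
qed

text \<open>With \<open>H' = 1 / Gfun\<close> and \<open>S' \<le> \<beta> * Gfun S\<close>, the
  composite \<open>H (S t)\<close> starts at 0 and grows at rate at most \<open>\<beta>\<close>. Up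
  to \<open>t = 1\<close> it cannot reach a level above \<open>\<beta>\<close>.\<close>

lemma majorant_bounded:
  fixes z :: "nat \<Rightarrow> nat \<Rightarrow> real" and \<alpha> \<beta> :: real
  assumes z: "\<And>i j. z i j \<ge> 0" and z0: "\<And>i. z i 0 = (if i = 1 then \<alpha> else 0)"
    and rec: "\<And>i j. real (Suc j) * z i (Suc j) \<le> \<beta> * (\<Sum>n\<le>i + Suc j. \<bar>kappa $ n\<bar> * conv_pow z n i j)"
    and \<alpha>: "0 \<le> \<alpha>" "\<alpha> < 2 * pi"
    and \<beta>: "0 \<le> \<beta>" "\<beta> < integral {\<alpha>..2 * pi} (\<lambda>u. 1 / Gfun u)"
  shows "(\<Sum>i\<le>Suc N. \<Sum>j\<le>Suc N. z i j) \<le> 2 * pi"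
proof -
  let ?g = "\<lambda>u. 1 / Gfun u"
  define H where "H x = integral {\<alpha>..x} ?g" for x
  \<comment> \<open>A non-integrable function would have integral 0, which cannot exceed
    \<open>\<beta> \<ge> 0\<close>.\<close>
  have "?g integrable_on {\<alpha>..2 * pi}"
    using \<beta> not_integrable_integral by fastforce
  then have "continuous_on {\<alpha>..2 * pi} H"
    unfolding H_def by (rule indefinite_integral_continuous_1)
  then have "(H \<longlongrightarrow> H (2 * pi)) (at (2 * pi) within {\<alpha>..2 * pi})"
    using \<alpha> by (auto simp: continuous_on_def)
  then have "eventually (\<lambda>x. \<beta> < H x) (at (2 * pi) within {\<alpha>..2 * pi})"
    by (rule order_tendstoD(1)) (use \<beta> in \<open>simp add: H_def\<close>)
  then obtain d where d: "d > 0" "\<And>x. x \<in> {\<alpha>..2 * pi} \<Longrightarrow> x \<noteq> 2 * pi \<Longrightarrow> dist x (2 * pi) < d \<Longrightarrow> \<beta> < H x"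
    unfolding eventually_at by blast
  \<comment> \<open>A barrier strictly below \<open>2 * pi\<close>, so that the bounds on
    \<open>Gfun\<close> apply, yet with \<open>H y > \<beta>\<close> by continuity of
    \<open>H\<close>; the midpoint keeps it above \<open>\<alpha>\<close>.\<close>
  define y where "y = max ((\<alpha> + 2 * pi) / 2) (2 * pi - d / 2)"
  have y: "\<alpha> < y" "y < 2 * pi" "\<beta> < H y"
  proof -
    show *: "\<alpha> < y" "y < 2 * pi" using \<alpha> d(1) by (auto simp: y_def max_def field_simps)
    have "dist y (2 * pi) < d" using * d(1) by (auto simp: y_def dist_real_def max_def field_simps)
    then show "\<beta> < H y" using * by (intro d(2)) auto
  qed
  have G1: "Gfun x \<ge> 1" if "x \<in> {\<alpha>..y}" for x
    using that \<alpha> y by (intro Gfun_ge_1) auto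
  have "continuous_on {\<alpha>..y} ?g"
    using G1 \<alpha> y by (intro continuous_on_divide continuous_on_const continuous_on_subset[OF continuous_on_Gfun])
      fastforce+
  then have dH: "(H has_real_derivative ?g x) (at x within {\<alpha>..y})" if "x \<in> {\<alpha>..y}" for x
    unfolding H_def using that by (rule integral_has_real_derivative)

  \<comment> \<open>\<open>Suc N\<close> ensures that the index \<open>i = 1\<close>, which carries
    \<open>\<alpha>\<close>, occurs in the sum.\<close>
  define M where "M = Suc N"
  define S where "S t = (\<Sum>i\<le>M. \<Sum>j\<le>M. z i j * t ^ j)" for t
  define S' where "S' t = (\<Sum>i\<le>M. \<Sum>j\<le>M. z i j * (real j * t ^ (j - 1)))" for t
  have dS: "(S has_real_derivative S' t) (at t within A)" for t A
    unfolding S_def S'_def by (auto intro!: derivative_eq_intros sum.cong)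
  have S0: "S 0 = \<alpha>"
  proof -
    have "S 0 = (\<Sum>i\<le>M. \<Sum>j\<le>M. if j = 0 then z i j else 0)"
      unfolding S_def by (intro sum.cong refl) auto
    also have "\<dots> = (\<Sum>i\<le>M. if i = 1 then \<alpha> else 0)"
      by (simp add: z0 cong: if_cong)
    also have "\<dots> = \<alpha>" by (simp add: M_def del: sum.atMost_Suc)
    finally show ?thesis .
  qed
  have S_mono: "S s \<le> S t" if "0 \<le> s" "s \<le> t" for s t
    unfolding S_def using that z by (intro sum_mono mult_left_mono power_mono)
  have S'_le: "S' t \<le> \<beta> * Gfun (S t)" if t: "t \<ge> 0" and St: "S t < 2 * pi" for t
  proof -
    have C: "conv_pow z n i j \<ge> 0" for n i j by (rule conv_pow_nonneg[OF z])
    have "S' t = (\<Sum>i\<le>M. \<Sum>j\<le>N. (real (Suc j) * z i (Suc j)) * t ^ j)"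
      unfolding S'_def M_def sum.atMost_Suc_shift[of _ N] by (simp add: mult_ac del: sum.atMost_Suc)
    \<comment> \<open>The bound \<open>2 * M\<close> covers every \<open>i + Suc j\<close> and does
      not depend on the indices, so the sums can be swapped.\<close>
    also have "\<dots> \<le> (\<Sum>i\<le>M. \<Sum>j\<le>N. (\<beta> * (\<Sum>n\<le>2 * M. \<bar>kappa $ n\<bar> * conv_pow z n i j)) * t ^ j)"
    proof (intro sum_mono mult_right_mono)
      fix i j assume ij: "i \<in> {..M}" "j \<in> {..N}"
      have "(\<Sum>n\<le>i + Suc j. \<bar>kappa $ n\<bar> * conv_pow z n i j) \<le> (\<Sum>n\<le>2 * M. \<bar>kappa $ n\<bar> * conv_pow z n i j)"
        using ij C by (intro sum_mono2) (auto simp: M_def)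
      with rec[of j i] \<beta>(1) show "real (Suc j) * z i (Suc j) \<le> \<beta> * (\<Sum>n\<le>2 * M. \<bar>kappa $ n\<bar> * conv_pow z n i j)"
        by (meson mult_left_mono order_trans)
    qed (use t in auto)
    also have "\<dots> \<le> (\<Sum>i\<le>M. \<Sum>j\<le>M. (\<beta> * (\<Sum>n\<le>2 * M. \<bar>kappa $ n\<bar> * conv_pow z n i j)) * t ^ j)"
    proof (intro sum_mono sum_mono2)
      show "{..N} \<subseteq> {..M}" by (simp add: M_def)
    qed (use t C \<beta> in \<open>auto intro!: mult_nonneg_nonneg sum_nonneg\<close>)
    also have "\<dots> = (\<Sum>i\<le>M. \<Sum>j\<le>M. \<Sum>n\<le>2 * M. \<beta> * (\<bar>kappa $ n\<bar> * (conv_pow z n i j * t ^ j)))"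
      by (simp only: sum_distrib_left sum_distrib_right mult.assoc)
    also have "\<dots> = (\<Sum>i\<le>M. \<Sum>n\<le>2 * M. \<Sum>j\<le>M. \<beta> * (\<bar>kappa $ n\<bar> * (conv_pow z n i j * t ^ j)))"
      by (rule sum.cong[OF refl sum.swap])
    also have "\<dots> = (\<Sum>n\<le>2 * M. \<Sum>i\<le>M. \<Sum>j\<le>M. \<beta> * (\<bar>kappa $ n\<bar> * (conv_pow z n i j * t ^ j)))"
      by (rule sum.swap)
    also have "\<dots> = \<beta> * (\<Sum>n\<le>2 * M. \<bar>kappa $ n\<bar> * (\<Sum>i\<le>M. \<Sum>j\<le>M. conv_pow z n i j * t ^ j))"
      by (simp only: sum_distrib_left)
    also have "\<dots> \<le> \<beta> * (\<Sum>n\<le>2 * M. \<bar>kappa $ n\<bar> * S t ^ n)"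
      unfolding S_def using \<beta>(1) t z by (intro mult_left_mono sum_mono conv_pow_sum_le) auto
    also have "\<dots> \<le> \<beta> * Gfun (S t)"
      using \<beta>(1) St S_mono[of 0 t] t S0 \<alpha>(1) by (intro mult_left_mono abs_kappa_partial_le_Gfun) auto
    finally show ?thesis .
  qed
  \<comment> \<open>Otherwise \<open>S\<close> takes the value \<open>y\<close> at some
    \<open>t \<le> 1\<close>, and the mean value theorem for \<open>H (S t)\<close> gives
    \<open>H y \<le> \<beta> * t \<le> \<beta>\<close>.\<close>
  have "S 1 < y"
  proof (rule ccontr)
    assume "\<not> S 1 < y"
    moreover have "continuous_on {0..1} S"
      using dS DERIV_continuous_on by blast
    ultimately obtain t where t: "0 \<le> t" "t \<le> 1" "S t = y"
      using IVT'[of S 0 y 1] S0 y(1) by auto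
    have "\<exists>x\<in>{0..t}. H (S t) - H (S 0) = ?g (S x) * S' x * (t - 0)"
    proof (rule mvt_very_simple[OF t(1)])
      fix x assume x: "0 \<le> x" "x \<le> t"
      \<comment> \<open>The derivative of \<open>H\<close> is available only within
        \<open>{\<alpha>..y}\<close>; monotonicity of \<open>S\<close> confines its values
        there.\<close>
      have sub: "S ` {0..t} \<subseteq> {\<alpha>..y}"
        using S_mono[of 0] S_mono[of _ t] S0 t by auto
      moreover have "S x \<in> {\<alpha>..y}" using sub x by (simp add: image_subset_iff)
      ultimately have "(H has_real_derivative ?g (S x)) (at (S x) within S ` {0..t})"
        by (intro DERIV_subset[OF dH])
      from DERIV_image_chain[OF this dS]
      show "((\<lambda>x. H (S x)) has_derivative (*) (?g (S x) * S' x)) (at x within {0..t})"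
        by (simp add: has_field_derivative_def o_def)
    qed
    then obtain x where x: "x \<in> {0..t}" "H (S t) - H (S 0) = ?g (S x) * S' x * t"
      by auto
    have Sx: "S x \<in> {\<alpha>..y}"
      using S_mono[of 0 x] S_mono[of x t] S0 t x by auto
    then have "?g (S x) * S' x \<le> \<beta>"
      using S'_le[of x] G1[of "S x"] x(1) y(2) by (auto simp: field_simps)
    then have "?g (S x) * S' x * t \<le> \<beta> * t"
      using t by (intro mult_right_mono) auto
    also have "\<dots> \<le> \<beta>" using t \<beta>(1) by (simp add: mult_left_le)
    finally have "H y \<le> \<beta>"
      using x(2) t S0 by (simp add: H_def)
    then show False using y by simp
  qed
  then show ?thesis using y by (simp add: S_def M_def)
qed

section \<open>Convergence\<close>

context lie_pair
begin

definition ev :: "ncs \<Rightarrow> 'a" where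
  "ev p = lie_eval br a b (coef p)"

definition is_lie :: "ncs \<Rightarrow> bool" where
  "is_lie p \<longleftrightarrow> coef p \<in> Lie_xy"

lemma is_lie_add: "is_lie p \<Longrightarrow> is_lie q \<Longrightarrow> is_lie (p + q) \<and> ev (p + q) = ev p + ev q"
  and is_lie_scaleR: "is_lie p \<Longrightarrow> is_lie (c *\<^sub>R p) \<and> ev (c *\<^sub>R p) = c *\<^sub>R ev p"
  and is_lie_commutator: "is_lie p \<Longrightarrow> is_lie q \<Longrightarrow>
    is_lie (p * q - q * p) \<and> ev (p * q - q * p) = br (ev p) (ev q)"
  using is_lie_morph_lie_eval
  by (auto simp: is_lie_def ev_def coef_fun_ops is_lie_morph_def intro: Lie_xy.intros)

lemma is_lie_x: "is_lie (Ncs PX)" "ev (Ncs PX) = a"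
  and is_lie_y: "is_lie nc_y" "ev nc_y = b"
  using is_lie_morph_lie_eval
  by (auto simp: is_lie_def ev_def nc_y_def is_lie_morph_def intro: Lie_xy.intros)

lemma is_lie_0: "is_lie 0 \<and> ev 0 = 0"
  using is_lie_scaleR[OF is_lie_x(1), of 0] by simp

lemma is_lie_sum:
  assumes "\<And>x. x \<in> A \<Longrightarrow> is_lie (f x)"
  shows "is_lie (sum f A) \<and> ev (sum f A) = (\<Sum>x\<in>A. ev (f x))"
  using assms by (induction A rule: infinite_finite_induct) (auto simp: is_lie_0 is_lie_add)

text \<open>Only components with at most \<open>j\<close> letters \<open>y\<close> are assumed to be
  Lie elements; this is what the induction in \<open>is_lie_bicomp_bch\<close> provides.\<close>

lemma is_lie_bch_iter:
  assumes "\<And>i' j'. j' \<le> j \<Longrightarrow> is_lie (bicomp i' j' bch)"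
  shows "is_lie (bch_iter n i j)"
  using assms
proof (induction n arbitrary: i j)
  case 0
  show ?case by (simp add: bch_iter_0 is_lie_y is_lie_0)
next
  case (Suc n)
  then show ?case
    unfolding bch_iter_Suc
    by (intro is_lie_sum[THEN conjunct1] is_lie_commutator[THEN conjunct1] Suc) auto
qed

lemma is_lie_bicomp_bch: "is_lie (bicomp i j bch)"
proof (induction j arbitrary: i rule: less_induct)
  case (less j)
  show ?case
  proof (cases j)
    case 0
    then show ?thesis by (simp add: bicomp_bch_x is_lie_x is_lie_0)
  next
    case (Suc k)
    have "is_lie (\<Sum>n\<le>i + Suc k. (kappa $ n) *\<^sub>R bch_iter n i k)"
      by (intro is_lie_sum[THEN conjunct1] is_lie_scaleR[THEN conjunct1] is_lie_bch_iter less) (simp add: Suc)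
    then have "is_lie ((1 / real (Suc k)) *\<^sub>R (real (Suc k) *\<^sub>R bicomp i (Suc k) bch))"
      unfolding bicomp_bch_Suc by (intro is_lie_scaleR[THEN conjunct1])
    then show ?thesis using Suc by simp
  qed
qed

lemma Zeval_eq_ev: "Zeval br i j a b = ev (bicomp i j bch)"
  by (simp add: Zeval_def ev_def Zpoly_eq_bicomp_bch)

lemma Zeval_0: "Zeval br i 0 a b = (if i = 1 then a else 0)"
  by (simp add: Zeval_eq_ev bicomp_bch_x is_lie_x is_lie_0)

lemma Zeval_Suc:
  "real (Suc j) *\<^sub>R Zeval br i (Suc j) a b = (\<Sum>n\<le>i + Suc j. (kappa $ n) *\<^sub>R ev (bch_iter n i j))"
proof -
  have "real (Suc j) *\<^sub>R Zeval br i (Suc j) a b = ev (real (Suc j) *\<^sub>R bicomp i (Suc j) bch)"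
    using is_lie_scaleR[OF is_lie_bicomp_bch] by (simp add: Zeval_eq_ev)
  also have "\<dots> = (\<Sum>n\<le>i + Suc j. ev ((kappa $ n) *\<^sub>R bch_iter n i j))"
    unfolding bicomp_bch_Suc
    by (intro is_lie_sum[THEN conjunct2] is_lie_scaleR[THEN conjunct1] is_lie_bch_iter is_lie_bicomp_bch)
  finally show ?thesis
    using is_lie_scaleR[OF is_lie_bch_iter[OF is_lie_bicomp_bch]] by simp
qed

text \<open>Each bracket is bounded by a product of norms, so iterated brackets are bounded by
  convolutions; the innermost entry \<open>y\<close> contributes \<open>norm b\<close>.\<close>

lemma norm_ev_bch_iter: "norm (ev (bch_iter n i j)) \<le> norm b * conv_pow (\<lambda>i j. norm (Zeval br i j a b)) n i j"
proof (induction n arbitrary: i j)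
  case 0
  show ?case by (simp add: bch_iter_0 is_lie_y is_lie_0)
next
  case (Suc n)
  let ?z = "\<lambda>i j. norm (Zeval br i j a b)"
  have lie: "is_lie (bch_iter n i j)" for i j
    by (rule is_lie_bch_iter[OF is_lie_bicomp_bch])
  have "ev (bch_iter (Suc n) i j) = (\<Sum>i'\<le>i. \<Sum>j'\<le>j. br (Zeval br i' j' a b) (ev (bch_iter n (i - i') (j - j'))))"
    unfolding bch_iter_Suc Zeval_eq_ev
    using is_lie_commutator[OF is_lie_bicomp_bch lie] by (simp add: is_lie_sum)
  then have "norm (ev (bch_iter (Suc n) i j)) \<le>
      (\<Sum>i'\<le>i. \<Sum>j'\<le>j. norm (br (Zeval br i' j' a b) (ev (bch_iter n (i - i') (j - j')))))"
    by (simp add: sum_norm_le)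
  also have "\<dots> \<le> (\<Sum>i'\<le>i. \<Sum>j'\<le>j. ?z i' j' * (norm b * conv_pow ?z n (i - i') (j - j')))"
    by (intro sum_mono order_trans[OF br_norm] mult_left_mono Suc.IH) simp
  also have "\<dots> = norm b * conv_pow ?z (Suc n) i j"
    by (simp add: sum_distrib_left mult_ac)
  finally show ?case .
qed

text \<open>The bound on the square sums is uniform in \<open>N\<close>, and each triangle lies in a
  square, so convergence is even absolute.\<close>

lemma summable_bch:
  assumes "norm a < 2 * pi" "norm b < integral {norm a..2 * pi} (\<lambda>u. 1 / Gfun u)"
  shows "summable (\<lambda>n. \<Sum>i\<le>n. Zeval br i (n - i) a b)"
proof -
  let ?z = "\<lambda>i j. norm (Zeval br i j a b)"
  have square: "(\<Sum>i\<le>Suc N. \<Sum>j\<le>Suc N. ?z i j) \<le> 2 * pi" for N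
  proof (rule majorant_bounded[of ?z "norm a" "norm b"])
    fix i j
    have "real (Suc j) * ?z i (Suc j) = norm (\<Sum>n\<le>i + Suc j. (kappa $ n) *\<^sub>R ev (bch_iter n i j))"
      unfolding Zeval_Suc[symmetric] by simp
    also have "\<dots> \<le> (\<Sum>n\<le>i + Suc j. \<bar>kappa $ n\<bar> * (norm b * conv_pow ?z n i j))"
      by (intro sum_norm_le) (auto intro!: mult_left_mono norm_ev_bch_iter)
    finally show "real (Suc j) * ?z i (Suc j) \<le> norm b * (\<Sum>n\<le>i + Suc j. \<bar>kappa $ n\<bar> * conv_pow ?z n i j)"
      by (simp add: sum_distrib_left mult_ac del: sum.atMost_Suc)
  qed (use assms in \<open>simp_all add: Zeval_0\<close>)
  have "summable (\<lambda>n. \<Sum>i\<le>n. ?z i (n - i))"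
  proof (rule bounded_imp_summable)
    fix N
    have "(\<Sum>n\<le>N. \<Sum>i\<le>n. ?z i (n - i)) \<le> (\<Sum>i\<le>N. \<Sum>j\<le>N. ?z i j)"
      by (rule sum_triangle_le_square) simp
    also have "\<dots> \<le> (\<Sum>i\<le>Suc N. \<Sum>j\<le>Suc N. ?z i j)"
      by (simp add: add_increasing2 sum_mono sum_nonneg)
    also have "\<dots> \<le> 2 * pi" by (rule square)
    finally show "(\<Sum>n\<le>N. \<Sum>i\<le>n. ?z i (n - i)) \<le> 2 * pi" .
  qed (simp add: sum_nonneg)
  then show ?thesis
    by (rule summable_comparison_test'[of _ 0]) (auto intro: norm_sum)
qed

end

section \<open>The symmetry that exchanges the two indeterminates\<close>

definition swap_gen :: "gen \<Rightarrow> gen" where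
  "swap_gen g = (case g of GX \<Rightarrow> GY | GY \<Rightarrow> GX)"

definition rev_swap :: "gen list \<Rightarrow> gen list" where
  "rev_swap w = rev (map swap_gen w)"

text \<open>Reversing words is an anti-automorphism, so its negative is a Lie morphism.\<close>

definition antimorph :: "ncpoly \<Rightarrow> ncpoly" where
  "antimorph p = (\<lambda>w. - p (rev_swap w))"

lemma rev_swap_rev_swap [simp]: "rev_swap (rev_swap w) = w"
proof -
  have "swap_gen \<circ> swap_gen = id"
    by (rule ext) (simp add: swap_gen_def split: gen.splits)
  then show ?thesis by (simp add: rev_swap_def rev_map)
qed

lemma rev_swap_eq_iff: "rev_swap w = v \<longleftrightarrow> w = rev_swap v"
  by auto

lemma pmult_rev_swap: "pmult p q (rev_swap w) = pmult (\<lambda>w. q (rev_swap w)) (\<lambda>w. p (rev_swap w)) w"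
  unfolding pmult_def
  by (rule sum.reindex_bij_witness[of _ "\<lambda>k. length w - k" "\<lambda>k. length w - k"])
    (auto simp: rev_swap_def take_rev drop_rev take_map drop_map)

lemma antimorph_pbr: "antimorph (pbr p q) = pbr (antimorph p) (antimorph q)"
proof -
  have "pmult (\<lambda>w. - p w) (\<lambda>w. - q w) = pmult p q" for p q
    by (simp add: pmult_def)
  then show ?thesis
    by (simp add: antimorph_def pbr_def pmult_rev_swap fun_eq_iff)
qed

lemma antimorph_simps:
  "antimorph (padd p q) = padd (antimorph p) (antimorph q)"
  "antimorph (psmult c p) = psmult c (antimorph p)"
  "antimorph PX = psmult (- 1) PY" "antimorph PY = psmult (- 1) PX"
  by (auto simp: antimorph_def padd_def psmult_def PX_def PY_def fun_eq_iff rev_swap_eq_iff)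
    (auto simp: rev_swap_def swap_gen_def)

lemma antimorph_Lie_xy: "p \<in> Lie_xy \<Longrightarrow> antimorph p \<in> Lie_xy"
  by (induction rule: Lie_xy.induct) (auto simp: antimorph_simps antimorph_pbr intro: Lie_xy.intros)

lemma word_of_append: "word_of (s @ t) = word_of s @ word_of t"
  by (simp add: word_of_def)

text \<open>Exchanging the letters destroys the block form \<open>x^i y^j\<close>; reversal restores
  it.\<close>

lemma word_of_rev_swap: "word_of (rev (map prod.swap s)) = rev_swap (word_of s)"
proof (induction s)
  case (Cons p s)
  have "rev_swap (xy_word i j) = xy_word j i" for i j
    by (simp add: xy_word_def rev_swap_def swap_gen_def)
  moreover have "rev_swap (v @ w) = rev_swap w @ rev_swap v" for v w
    by (simp add: rev_swap_def)
  ultimately show ?case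
    using Cons.IH by (simp add: word_of_append)
qed (simp add: rev_swap_def)

text \<open>Reversing a sequence and swapping its pairs keeps the weight and exchanges
  \<open>i\<close> with \<open>j\<close>.\<close>

lemma Zpoly_rev_swap: "Zpoly i j (rev_swap w) = Zpoly j i w"
proof -
  have "(\<Sum>s\<in>seqs n i j. if word_of s = rev_swap w then 1 / (\<Prod>p\<leftarrow>s. fact (fst p) * fact (snd p)) else 0) =
      (\<Sum>s\<in>seqs n j i. if word_of s = w then 1 / (\<Prod>p\<leftarrow>s. fact (fst p) * fact (snd p)) else (0::real))" for n
  proof (rule sum.reindex_bij_witness[of _ "\<lambda>s. rev (map prod.swap s)" "\<lambda>s. rev (map prod.swap s)"])
    fix s
    have prod: "(\<Prod>p\<leftarrow>rev (map prod.swap s). fact (fst p) * fact (snd p)) = (\<Prod>p\<leftarrow>s. fact (fst p) * fact (snd p) :: real)"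
      by (induction s) (simp_all add: mult_ac)
    show "(if word_of (rev (map prod.swap s)) = w then 1 / (\<Prod>p\<leftarrow>rev (map prod.swap s). fact (fst p) * fact (snd p)) else 0) =
        (if word_of s = rev_swap w then 1 / (\<Prod>p\<leftarrow>s. fact (fst p) * fact (snd p)) else (0::real))"
      unfolding prod word_of_rev_swap rev_swap_eq_iff ..
  qed (auto simp: seqs_def rev_map[symmetric] o_def sum_list_rev)
  then show ?thesis by (simp add: Zpoly_def add.commute)
qed

context lie_pair
begin

text \<open>Evaluation at \<open>(- b, - a)\<close> after \<open>antimorph\<close> sends
  \<open>x\<close> to \<open>a\<close> and \<open>y\<close> to \<open>b\<close>, since the two signs
  cancel; by uniqueness it is evaluation at \<open>(a, b)\<close>.\<close>

lemma Zeval_swap: "Zeval br i j a b = - Zeval br j i (- b) (- a)"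
proof -
  interpret neg: lie_pair br "- b" "- a" by unfold_locales (rule lie)
  have morph: "neg.is_lie_morph (lie_eval br (- b) (- a))"
    by (rule neg.is_lie_morph_lie_eval)
  then have neg: "lie_eval br (- b) (- a) (psmult (- 1) p) = - lie_eval br (- b) (- a) p" if "p \<in> Lie_xy" for p
    using that by (simp add: neg.is_lie_morph_def)
  have "is_lie_morph (\<lambda>p. lie_eval br (- b) (- a) (antimorph p))"
    using morph unfolding is_lie_morph_def neg.is_lie_morph_def
    by (simp add: antimorph_simps antimorph_pbr antimorph_Lie_xy Lie_xy.intros)
  moreover have Z: "Zpoly i j \<in> Lie_xy" for i j
    using is_lie_bicomp_bch by (simp add: is_lie_def Zpoly_eq_bicomp_bch)
  ultimately have "lie_eval br a b (Zpoly i j) = lie_eval br (- b) (- a) (antimorph (Zpoly i j))"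
    by (intro is_lie_morph_unique[OF is_lie_morph_lie_eval])
  also have "antimorph (Zpoly i j) = psmult (- 1) (Zpoly j i)"
    by (simp add: antimorph_def Zpoly_rev_swap psmult_def)
  finally show ?thesis
    by (simp add: Zeval_def neg[OF Z])
qed

text \<open>Passing to \<open>(- b, - a)\<close> exchanges the two norms and so maps the second
  region into the first.\<close>

lemma summable_bch':
  assumes "norm b < 2 * pi" "norm a < integral {norm b..2 * pi} (\<lambda>u. 1 / Gfun u)"
  shows "summable (\<lambda>n. \<Sum>i\<le>n. Zeval br i (n - i) a b)"
proof -
  interpret neg: lie_pair br "- b" "- a" by unfold_locales (rule lie)
  have "(\<Sum>i\<le>n. Zeval br i (n - i) a b) = - (\<Sum>i\<le>n. Zeval br i (n - i) (- b) (- a))" for n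
  proof -
    have "(\<Sum>i\<le>n. Zeval br i (n - i) a b) = (\<Sum>i\<le>n. - Zeval br (n - i) i (- b) (- a))"
      by (intro sum.cong refl Zeval_swap)
    also have "\<dots> = - (\<Sum>i\<le>n. Zeval br (n - i) i (- b) (- a))"
      by (rule sum_negf)
    also have "(\<Sum>i\<le>n. Zeval br (n - i) i (- b) (- a)) = (\<Sum>i\<le>n. Zeval br i (n - i) (- b) (- a))"
      by (rule sum.reindex_bij_witness[of _ "\<lambda>k. n - k" "\<lambda>k. n - k"]) auto
    finally show ?thesis .
  qed
  moreover have "summable (\<lambda>n. \<Sum>i\<le>n. Zeval br i (n - i) (- b) (- a))"
    using assms by (intro neg.summable_bch) simp_all
  ultimately show ?thesis
    by (simp add: summable_minus)
qed

end

theorem mainTheorem11: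
  fixes br :: "'a::banach \<Rightarrow> 'a \<Rightarrow> 'a"
  assumes "banach_lie br"
  shows "\<forall>a b. ((norm a < 2 * pi \<and> norm b < integral {norm a..2 * pi} (\<lambda>u. 1 / Gfun u))
                 \<or> (norm b < 2 * pi \<and> norm a < integral {norm b..2 * pi} (\<lambda>u. 1 / Gfun u)))
           \<longrightarrow> summable (\<lambda>n. \<Sum>i\<le>n. Zeval br i (n - i) a b)"
proof (intro allI impI)
  fix a b :: 'a
  assume *: "(norm a < 2 * pi \<and> norm b < integral {norm a..2 * pi} (\<lambda>u. 1 / Gfun u))
                 \<or> (norm b < 2 * pi \<and> norm a < integral {norm b..2 * pi} (\<lambda>u. 1 / Gfun u))"
  interpret lie_pair br a b by unfold_locales (rule assms)
  show "summable (\<lambda>n. \<Sum>i\<le>n. Zeval br i (n - i) a b)"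
    using * by (elim disjE conjE) (rule summable_bch summable_bch'; assumption)+
qed

end
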